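(* Let $q\in\mathbb{Q}$ be nonzero, $m\in\mathbb{Q}$ with $m\neq 0,q^2$, $(x_1,y_1)\in\mathcal{D}_m(\mathbb{Q})$, and let $g$ be the function on $E_m$ defined in the context. For all $P,Q\in E_m(\mathbb{Q})$ we have $g(P+Q)\equiv g(P)g(Q)\pmod{(\mathbb{Q}^* )^2}$. In particular, if $P\equiv Q\pmod{2E_m(\mathbb{Q})}$ then $g(P)\equiv g(Q)\pmod{(\mathbb{Q}^* )^2}$.
   Context: Let $\mathcal{D}_m\colon (X^2-q)(Y^2-q)=m$, with projective closure $\overline{\mathcal{D}}_m\colon (X^2-qZ^2)(Y^2-qZ^2)=mZ^4$, and $E_m\colon W^2=T^3+(4q^2-2m)T^2+m^2T$. Fix $(x_1,y_1)\in\mathcal{D}_m(\mathbb{Q})$. The birational map $f\colon\mathcal{D}_m\to E_m$ is $T=(y_1^2-q)\cdot\frac{2x_1(y^2-q)x+(x_1^2+q)y^2+x_1^2y_1^2-2x_1^2q-y_1^2q}{(y-y_1)^2}$, $W=T\cdot\frac{2y_1x(q-y^2)+2x_1y(q-y_1^2)}{y^2-y_1^2}$, sending $(x_1,y_1)$ to the point at infinity. Its inverse $f^{-1}\colon E_m\to\overline{\mathcal{D}}_m$ is a morphism; write $x\circ f^{-1}(P)=X(f^{-1}(P))/Z(f^{-1}(P))$. Define $g(P)=(x_1^2-q)\big((x\circ f^{-1}(P))^2-q\big)$. The notation $A\equiv B\pmod{(\mathbb{Q}^* )^2}$ means $A$ and $B$ differ by a factor that is the square of a nonzero rational.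
   Formalization: If q is a rational square, some rational points of E_m lie over points with Z=0, where g has no value; the congruences are stated for P, Q (and P+Q in the first) where g is defined, and g is shown to be defined on all of E_m(Q) when q is not a rational square. *)

theory Defs
  imports Complex_Main
begin

section \<open>The curves\<close>

text \<open>
  Both curves are taken with their complex points; coordinates in \<^term>\<open>\<rat> :: complex set\<close>
  single out the rational points.  The complex points are needed because the rational points of
  the elliptic curve may be finite in number and would then not determine a morphism.
\<close>

definition quartic :: "complex \<Rightarrow> complex \<Rightarrow> (complex \<times> complex) set" where
  "quartic q m = {(x, y). (x^2 - q) * (y^2 - q) = m}"

text \<open>Points of the projective plane are represented by homogeneous coordinates.\<close>

definition proj_eq :: "complex \<times> complex \<times> complex \<Rightarrow> complex \<times> complex \<times> complex \<Rightarrow> bool" where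
  "proj_eq u v \<longleftrightarrow> (case u of (X, Y, Z) \<Rightarrow> case v of (X', Y', Z') \<Rightarrow>
     \<exists>c. c \<noteq> 0 \<and> X = c * X' \<and> Y = c * Y' \<and> Z = c * Z')"

definition quartic_closure :: "complex \<Rightarrow> complex \<Rightarrow> (complex \<times> complex \<times> complex) set" where
  "quartic_closure q m =
     {(X, Y, Z). (X, Y, Z) \<noteq> (0, 0, 0) \<and> (X^2 - q * Z^2) * (Y^2 - q * Z^2) = m * Z^4}"

datatype ec_point = Infty | Affine complex complex

definition ec :: "complex \<Rightarrow> complex \<Rightarrow> ec_point set" where
  "ec q m = insert Infty
     {Affine T W | T W. W^2 = T^3 + (4 * q^2 - 2 * m) * T^2 + m^2 * T}"

definition ec_rat :: "complex \<Rightarrow> complex \<Rightarrow> ec_point set" where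
  "ec_rat q m = ec q m \<inter> insert Infty {Affine T W | T W. T \<in> \<rat> \<and> W \<in> \<rat>}"

fun ec_neg :: "ec_point \<Rightarrow> ec_point" where
  "ec_neg Infty = Infty"
| "ec_neg (Affine T W) = Affine T (- W)"

text \<open>The chord-and-tangent law.\<close>

fun ec_add :: "complex \<Rightarrow> complex \<Rightarrow> ec_point \<Rightarrow> ec_point \<Rightarrow> ec_point" where
  "ec_add q m Infty P = P"
| "ec_add q m (Affine T1 W1) Infty = Affine T1 W1"
| "ec_add q m (Affine T1 W1) (Affine T2 W2) =
     (if T1 = T2 \<and> W1 = - W2 then Infty
      else let l = (if T1 = T2
                    then (3 * T1^2 + 2 * (4 * q^2 - 2 * m) * T1 + m^2) / (2 * W1)
                    else (W2 - W1) / (T2 - T1));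
               T3 = l^2 - (4 * q^2 - 2 * m) - T1 - T2
           in Affine T3 (- (W1 + l * (T3 - T1))))"

definition cong_2E :: "complex \<Rightarrow> complex \<Rightarrow> ec_point \<Rightarrow> ec_point \<Rightarrow> bool" where
  "cong_2E q m P Q \<longleftrightarrow> (\<exists>R\<in>ec_rat q m. ec_add q m P (ec_neg Q) = ec_add q m R R)"


section \<open>The birational map and its inverse\<close>

text \<open>Meaningful where \<open>y\<^sup>2 \<noteq> y1\<^sup>2\<close>; elsewhere a denominator vanishes.\<close>

definition f_map :: "complex \<Rightarrow> complex \<Rightarrow> complex \<Rightarrow> complex \<Rightarrow> complex \<Rightarrow> ec_point" where
  "f_map q x1 y1 x y =
     (let T = (y1^2 - q) *
            ((2 * x1 * (y^2 - q) * x + (x1^2 + q) * y^2 + x1^2 * y1^2 - 2 * x1^2 * q - y1^2 * q)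
              / (y - y1)^2);
          W = T * ((2 * y1 * x * (q - y^2) + 2 * x1 * y * (q - y1^2)) / (y^2 - y1^2))
      in Affine T W)"

text \<open>Ternary forms of a given degree with rational coefficients, as functions.\<close>

inductive rat_form :: "nat \<Rightarrow> (complex \<Rightarrow> complex \<Rightarrow> complex \<Rightarrow> complex) \<Rightarrow> bool" where
  const: "c \<in> \<rat> \<Longrightarrow> rat_form 0 (\<lambda>T W S. c)"
| var1: "rat_form 1 (\<lambda>T W S. T)"
| var2: "rat_form 1 (\<lambda>T W S. W)"
| var3: "rat_form 1 (\<lambda>T W S. S)"
| add: "rat_form d F \<Longrightarrow> rat_form d G \<Longrightarrow> rat_form d (\<lambda>T W S. F T W S + G T W S)"
| mult: "rat_form d F \<Longrightarrow> rat_form e G \<Longrightarrow> rat_form (d + e) (\<lambda>T W S. F T W S * G T W S)"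

text \<open>Homogeneous coordinates \<open>[T : W : S]\<close> on the Weierstrass curve.\<close>

fun hcoords :: "ec_point \<Rightarrow> complex \<times> complex \<times> complex" where
  "hcoords Infty = (0, 1, 0)"
| "hcoords (Affine T W) = (T, W, 1)"

definition eval_forms ::
  "(complex \<Rightarrow> complex \<Rightarrow> complex \<Rightarrow> complex) \<Rightarrow> (complex \<Rightarrow> complex \<Rightarrow> complex \<Rightarrow> complex) \<Rightarrow>
   (complex \<Rightarrow> complex \<Rightarrow> complex \<Rightarrow> complex) \<Rightarrow> ec_point \<Rightarrow> complex \<times> complex \<times> complex" where
  "eval_forms F G H P = (case hcoords P of (T, W, S) \<Rightarrow> (F T W S, G T W S, H T W S))"

text \<open>
  Morphisms over the rationals from the Weierstrass curve to the closure of the quartic: near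
  every point the map is given by three forms of one degree without common zero there.  On an
  irreducible curve such forms give the map wherever they do not vanish simultaneously.
\<close>

definition morphism :: "complex \<Rightarrow> complex \<Rightarrow> (ec_point \<Rightarrow> complex \<times> complex \<times> complex) \<Rightarrow> bool" where
  "morphism q m \<phi> \<longleftrightarrow>
     (\<forall>P\<in>ec q m. \<phi> P \<in> quartic_closure q m) \<and>
     (\<forall>P\<in>ec q m. \<exists>d F G H. rat_form d F \<and> rat_form d G \<and> rat_form d H \<and>
        eval_forms F G H P \<noteq> (0, 0, 0) \<and>
        (\<forall>Q\<in>ec q m. eval_forms F G H Q \<noteq> (0, 0, 0) \<longrightarrow> proj_eq (\<phi> Q) (eval_forms F G H Q)))"

definition inverse_morphism ::
  "complex \<Rightarrow> complex \<Rightarrow> complex \<Rightarrow> complex \<Rightarrow> (ec_point \<Rightarrow> complex \<times> complex \<times> complex) \<Rightarrow> bool" where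
  "inverse_morphism q m x1 y1 \<phi> \<longleftrightarrow>
     morphism q m \<phi> \<and>
     (\<forall>x y. (x, y) \<in> quartic q m \<longrightarrow> y^2 \<noteq> y1^2 \<longrightarrow>
        f_map q x1 y1 x y \<in> ec q m \<and> proj_eq (\<phi> (f_map q x1 y1 x y)) (x, y, 1)) \<and>
     (\<forall>P\<in>ec q m. \<forall>x y. proj_eq (\<phi> P) (x, y, 1) \<longrightarrow> y^2 \<noteq> y1^2 \<longrightarrow> f_map q x1 y1 x y = P)"

text \<open>
  Such a morphism exists (lemma \<open>inverse_morphism_f_inv\<close> below).  Its values at points of the
  curve are unique up to rescaling of homogeneous coordinates.
\<close>

definition f_inv ::
  "complex \<Rightarrow> complex \<Rightarrow> complex \<Rightarrow> complex \<Rightarrow> ec_point \<Rightarrow> complex \<times> complex \<times> complex" where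
  "f_inv q m x1 y1 = (SOME \<phi>. inverse_morphism q m x1 y1 \<phi>)"

definition x_f_inv :: "complex \<Rightarrow> complex \<Rightarrow> complex \<Rightarrow> complex \<Rightarrow> ec_point \<Rightarrow> complex" where
  "x_f_inv q m x1 y1 P = (case f_inv q m x1 y1 P of (X, Y, Z) \<Rightarrow> X / Z)"

definition g :: "complex \<Rightarrow> complex \<Rightarrow> complex \<Rightarrow> complex \<Rightarrow> ec_point \<Rightarrow> complex" where
  "g q m x1 y1 P = (x1^2 - q) * ((x_f_inv q m x1 y1 P)^2 - q)"

text \<open>
  The points where \<open>X/Z\<close>, and hence \<open>g\<close>, has a value.  The points at infinity of the closure lie
  on branches that are rational over the field generated by \<open>\<surd>q\<close>, so this can fail at
  rational points only if \<open>q\<close> is a rational square.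
\<close>

definition g_defined :: "complex \<Rightarrow> complex \<Rightarrow> complex \<Rightarrow> complex \<Rightarrow> ec_point \<Rightarrow> bool" where
  "g_defined q m x1 y1 P \<longleftrightarrow> (case f_inv q m x1 y1 P of (X, Y, Z) \<Rightarrow> Z \<noteq> 0)"

definition sq_cong :: "complex \<Rightarrow> complex \<Rightarrow> bool" where
  "sq_cong A B \<longleftrightarrow> A \<in> \<rat> \<and> B \<in> \<rat> \<and> (\<exists>s\<in>\<rat>. s \<noteq> 0 \<and> A = B * s^2)"


section \<open>Existence of the inverse morphism\<close>

text \<open>
  On the Weierstrass curve the coordinate \<open>x\<close> of the inverse is a quotient of two linear forms,
  vanishing together in one point, where a quotient of quadratic forms takes over.
  Exchanging \<open>(x, x1)\<close> with \<open>(y, y1)\<close> negates \<open>W\<close>, which gives the coordinate \<open>y\<close>.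
\<close>

definition lin1 where
  "lin1 q x y T W S = x*y*W + (x^2*(y^2-q) - 2*q*y^2)*T - x^2*(y^2-q)*((x^2-q)*(y^2-q))*S"
  for q x y T W S :: complex

definition lin2 where
  "lin2 q x y T W S = y*W - x*(y^2+q)*T + x*(y^2-q)*((x^2-q)*(y^2-q))*S"
  for q x y T W S :: complex

definition cof where
  "cof q x y T S = T^2 + (4*q^2 - 2*((x^2-q)*(y^2-q)))*T*S + ((x^2-q)*(y^2-q))^2*S^2"
  for q x y T S :: complex

definition quad1 where
  "quad1 q x y T W S =
     (if x = 0 then -(2*q*y*W*S)
      else if y = 0 then x*(W^2 - ((x^2-q)*(y^2-q))*cof q x y T S)
      else x*y*((x^2-q)*(y^2-q))*W*S - (x^2*(y^2-q) - 2*q*y^2)*((x^2-q)*(y^2-q))*T*S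
           + x^2*(y^2-q)*T^2)"
  for q x y T W S :: complex

definition quad2 where
  "quad2 q x y T W S =
     (if x = 0 then cof q x y T S
      else if y = 0 then W^2 + ((x^2-q)*(y^2-q))*cof q x y T S
      else -(y*((x^2-q)*(y^2-q))*W*S) - x*(y^2+q)*((x^2-q)*(y^2-q))*T*S + x*(y^2-q)*T^2)"
  for q x y T W S :: complex

definition on_curve where
  "on_curve q x y T W S \<longleftrightarrow>
     W^2*S = T^3 + (4*q^2 - 2*((x^2-q)*(y^2-q)))*T^2*S + ((x^2-q)*(y^2-q))^2*T*S^2"
  for q x y T W S :: complex

lemmas chart_defs = lin1_def lin2_def cof_def

lemma quad_cases:
  fixes q x y T W S :: complex
  shows "x = 0 \<Longrightarrow> quad1 q x y T W S = -(2*q*y*W*S)"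
    and "x = 0 \<Longrightarrow> quad2 q x y T W S = cof q x y T S"
    and "x \<noteq> 0 \<Longrightarrow> y = 0 \<Longrightarrow>
           quad1 q x y T W S = x*(W^2 - ((x^2-q)*(y^2-q))*cof q x y T S)"
    and "x \<noteq> 0 \<Longrightarrow> y = 0 \<Longrightarrow> quad2 q x y T W S = W^2 + ((x^2-q)*(y^2-q))*cof q x y T S"
    and "x \<noteq> 0 \<Longrightarrow> y \<noteq> 0 \<Longrightarrow> quad1 q x y T W S =
           x*y*((x^2-q)*(y^2-q))*W*S - (x^2*(y^2-q) - 2*q*y^2)*((x^2-q)*(y^2-q))*T*S
           + x^2*(y^2-q)*T^2"
    and "x \<noteq> 0 \<Longrightarrow> y \<noteq> 0 \<Longrightarrow> quad2 q x y T W S =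
           -(y*((x^2-q)*(y^2-q))*W*S) - x*(y^2+q)*((x^2-q)*(y^2-q))*T*S + x*(y^2-q)*T^2"
  unfolding quad1_def quad2_def by auto

definition is_chart where
  "is_chart q x y T W S p1 p2 \<longleftrightarrow>
     (p1 = lin1 q x y T W S \<and> p2 = lin2 q x y T W S) \<or>
     (p1 = quad1 q x y T W S \<and> p2 = quad2 q x y T W S)"
  for q x y T W S p1 p2 :: complex

lemma chart_compat:
  fixes q x y T W S :: complex
  assumes "on_curve q x y T W S" "\<not> (x = 0 \<and> y = 0)"
  shows "lin1 q x y T W S * quad2 q x y T W S = lin2 q x y T W S * quad1 q x y T W S"
proof -
  note c = assms(1)[unfolded on_curve_def]
  consider "x = 0" "y \<noteq> 0" | "x \<noteq> 0" "y = 0" | "x \<noteq> 0" "y \<noteq> 0" using assms(2) by blast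
  then show ?thesis
  proof cases
    case 1 show ?thesis unfolding quad_cases(1,2)[OF 1(1)] chart_defs using c 1(1) by algebra
  next
    case 2 show ?thesis unfolding quad_cases(3,4)[OF 2] chart_defs using c 2(2) by algebra
  next
    case 3 show ?thesis unfolding quad_cases(5,6)[OF 3] chart_defs using c by algebra
  qed
qed

lemmas clean = power_zero_numeral mult_zero_left mult_zero_right diff_0 diff_0_right add_0_left add_0_right minus_zero

definition identities where
  "identities q x y T W S p1 p2 r1 r2 \<longleftrightarrow>
     (p1^2 - q*p2^2) * (r1^2 - q*r2^2) = ((x^2-q)*(y^2-q)) * p2^2 * r2^2 \<and>
     T * (r1 - y*r2)^2 * p2^2 = (y^2-q) * (r1^2 - q*r2^2) * (p1 + x*p2)^2 * S \<and>
     W * (r1^2 - y^2*r2^2) * p2 = T * (2*y*p1*(q*r2^2 - r1^2) + 2*x*r1*r2*p2*(q - y^2))"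
  for q x y T W S p1 p2 r1 r2 :: complex

lemma identities_x0:
  fixes q x y T W S :: complex
  assumes "on_curve q x y T W S" "x = 0" "y \<noteq> 0"
  shows "identities q x y T W S (lin1 q x y T W S) (lin2 q x y T W S)
           (lin1 q y x T (-W) S) (lin2 q y x T (-W) S)"
    and "identities q x y T W S (lin1 q x y T W S) (lin2 q x y T W S)
           (quad1 q y x T (-W) S) (quad2 q y x T (-W) S)"
    and "identities q x y T W S (quad1 q x y T W S) (quad2 q x y T W S)
           (lin1 q y x T (-W) S) (lin2 q y x T (-W) S)"
    and "identities q x y T W S (quad1 q x y T W S) (quad2 q x y T W S)
           (quad1 q y x T (-W) S) (quad2 q y x T (-W) S)"
proof -
  note facts = assms(1)[unfolded on_curve_def assms(2) clean]
  note eqs = quad_cases(1,2)[OF assms(2)] quad_cases(3,4)[OF assms(3,2)]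
  show "identities q x y T W S (lin1 q x y T W S) (lin2 q x y T W S)
           (lin1 q y x T (-W) S) (lin2 q y x T (-W) S)"
    unfolding identities_def eqs chart_defs unfolding assms(2) clean
    apply (intro conjI)
    subgoal using facts by (algebra | simp add: algebra_simps power2_eq_square)
    subgoal using facts by (algebra | simp add: algebra_simps power2_eq_square)
    subgoal using facts by (algebra | simp add: algebra_simps power2_eq_square)
    done
  show "identities q x y T W S (lin1 q x y T W S) (lin2 q x y T W S)
           (quad1 q y x T (-W) S) (quad2 q y x T (-W) S)"
    unfolding identities_def eqs chart_defs unfolding assms(2) clean
    apply (intro conjI)
    subgoal using facts by (algebra | simp add: algebra_simps power2_eq_square)
    subgoal using facts by (algebra | simp add: algebra_simps power2_eq_square)
    subgoal using facts by (algebra | simp add: algebra_simps power2_eq_square)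
    done
  show "identities q x y T W S (quad1 q x y T W S) (quad2 q x y T W S)
           (lin1 q y x T (-W) S) (lin2 q y x T (-W) S)"
    unfolding identities_def eqs chart_defs unfolding assms(2) clean
    apply (intro conjI)
    subgoal using facts by (algebra | simp add: algebra_simps power2_eq_square)
    subgoal using facts by (algebra | simp add: algebra_simps power2_eq_square)
    subgoal using facts by (algebra | simp add: algebra_simps power2_eq_square)
    done
  show "identities q x y T W S (quad1 q x y T W S) (quad2 q x y T W S)
           (quad1 q y x T (-W) S) (quad2 q y x T (-W) S)"
    unfolding identities_def eqs chart_defs unfolding assms(2) clean
    apply (intro conjI)
    subgoal using facts by (algebra | simp add: algebra_simps power2_eq_square)
    subgoal using facts by (algebra | simp add: algebra_simps power2_eq_square)
    subgoal using facts by (algebra | simp add: algebra_simps power2_eq_square)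
    done
qed

lemma identities_y0:
  fixes q x y T W S :: complex
  assumes "on_curve q x y T W S" "x \<noteq> 0" "y = 0"
  shows "identities q x y T W S (lin1 q x y T W S) (lin2 q x y T W S)
           (lin1 q y x T (-W) S) (lin2 q y x T (-W) S)"
    and "identities q x y T W S (lin1 q x y T W S) (lin2 q x y T W S)
           (quad1 q y x T (-W) S) (quad2 q y x T (-W) S)"
    and "identities q x y T W S (quad1 q x y T W S) (quad2 q x y T W S)
           (lin1 q y x T (-W) S) (lin2 q y x T (-W) S)"
    and "identities q x y T W S (quad1 q x y T W S) (quad2 q x y T W S)
           (quad1 q y x T (-W) S) (quad2 q y x T (-W) S)"
proof -
  note facts = assms(1)[unfolded on_curve_def assms(3) clean]
  note eqs = quad_cases(3,4)[OF assms(2,3)] quad_cases(1,2)[OF assms(3)]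
  show "identities q x y T W S (lin1 q x y T W S) (lin2 q x y T W S)
           (lin1 q y x T (-W) S) (lin2 q y x T (-W) S)"
    unfolding identities_def eqs chart_defs unfolding assms(3) clean
    apply (intro conjI)
    subgoal using facts by (algebra | simp add: algebra_simps power2_eq_square)
    subgoal using facts by (algebra | simp add: algebra_simps power2_eq_square)
    subgoal using facts by (algebra | simp add: algebra_simps power2_eq_square)
    done
  show "identities q x y T W S (lin1 q x y T W S) (lin2 q x y T W S)
           (quad1 q y x T (-W) S) (quad2 q y x T (-W) S)"
    unfolding identities_def eqs chart_defs unfolding assms(3) clean
    apply (intro conjI)
    subgoal using facts by (algebra | simp add: algebra_simps power2_eq_square)
    subgoal using facts by (algebra | simp add: algebra_simps power2_eq_square)
    subgoal using facts by (algebra | simp add: algebra_simps power2_eq_square)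
    done
  show "identities q x y T W S (quad1 q x y T W S) (quad2 q x y T W S)
           (lin1 q y x T (-W) S) (lin2 q y x T (-W) S)"
    unfolding identities_def eqs chart_defs unfolding assms(3) clean
    apply (intro conjI)
    subgoal using facts by (algebra | simp add: algebra_simps power2_eq_square)
    subgoal using facts by (algebra | simp add: algebra_simps power2_eq_square)
    subgoal using facts by (algebra | simp add: algebra_simps power2_eq_square)
    done
  show "identities q x y T W S (quad1 q x y T W S) (quad2 q x y T W S)
           (quad1 q y x T (-W) S) (quad2 q y x T (-W) S)"
    unfolding identities_def eqs chart_defs unfolding assms(3) clean
    apply (intro conjI)
    subgoal using facts by (algebra | simp add: algebra_simps power2_eq_square)
    subgoal using facts by (algebra | simp add: algebra_simps power2_eq_square)
    subgoal using facts by (algebra | simp add: algebra_simps power2_eq_square)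
    done
qed

lemma identities_xy:
  fixes q x y T W S :: complex
  assumes "on_curve q x y T W S" "x \<noteq> 0" "y \<noteq> 0"
  shows "identities q x y T W S (lin1 q x y T W S) (lin2 q x y T W S)
           (lin1 q y x T (-W) S) (lin2 q y x T (-W) S)"
    and "identities q x y T W S (lin1 q x y T W S) (lin2 q x y T W S)
           (quad1 q y x T (-W) S) (quad2 q y x T (-W) S)"
    and "identities q x y T W S (quad1 q x y T W S) (quad2 q x y T W S)
           (lin1 q y x T (-W) S) (lin2 q y x T (-W) S)"
    and "identities q x y T W S (quad1 q x y T W S) (quad2 q x y T W S)
           (quad1 q y x T (-W) S) (quad2 q y x T (-W) S)"
proof -
  note facts = assms(1)[unfolded on_curve_def]
  note eqs = quad_cases(5,6)[OF assms(2,3)] quad_cases(5,6)[OF assms(3,2)]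
  show "identities q x y T W S (lin1 q x y T W S) (lin2 q x y T W S)
           (lin1 q y x T (-W) S) (lin2 q y x T (-W) S)"
    unfolding identities_def eqs chart_defs 
    apply (intro conjI)
    subgoal using facts by (algebra | simp add: algebra_simps power2_eq_square)
    subgoal using facts by (algebra | simp add: algebra_simps power2_eq_square)
    subgoal using facts by (algebra | simp add: algebra_simps power2_eq_square)
    done
  show "identities q x y T W S (lin1 q x y T W S) (lin2 q x y T W S)
           (quad1 q y x T (-W) S) (quad2 q y x T (-W) S)"
    unfolding identities_def eqs chart_defs 
    apply (intro conjI)
    subgoal using facts by (algebra | simp add: algebra_simps power2_eq_square)
    subgoal using facts by (algebra | simp add: algebra_simps power2_eq_square)
    subgoal using facts by (algebra | simp add: algebra_simps power2_eq_square)
    done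
  show "identities q x y T W S (quad1 q x y T W S) (quad2 q x y T W S)
           (lin1 q y x T (-W) S) (lin2 q y x T (-W) S)"
    unfolding identities_def eqs chart_defs 
    apply (intro conjI)
    subgoal using facts by (algebra | simp add: algebra_simps power2_eq_square)
    subgoal using facts by (algebra | simp add: algebra_simps power2_eq_square)
    subgoal using facts by (algebra | simp add: algebra_simps power2_eq_square)
    done
  show "identities q x y T W S (quad1 q x y T W S) (quad2 q x y T W S)
           (quad1 q y x T (-W) S) (quad2 q y x T (-W) S)"
    unfolding identities_def eqs chart_defs 
    apply (intro conjI)
    subgoal using facts by (algebra | simp add: algebra_simps power2_eq_square)
    subgoal using facts by (algebra | simp add: algebra_simps power2_eq_square)
    subgoal using facts by (algebra | simp add: algebra_simps power2_eq_square)
    done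
qed

lemma chart_identities:
  fixes q x y T W S p1 p2 r1 r2 :: complex
  assumes c: "on_curve q x y T W S" and nz: "\<not> (x = 0 \<and> y = 0)"
    and p: "is_chart q x y T W S p1 p2" and r: "is_chart q y x T (-W) S r1 r2"
  shows "identities q x y T W S p1 p2 r1 r2"
proof -
  consider "x = 0" "y \<noteq> 0" | "x \<noteq> 0" "y = 0" | "x \<noteq> 0" "y \<noteq> 0" using nz by blast
  then show ?thesis
  proof cases
    case 1 show ?thesis using p r identities_x0[OF c 1] unfolding is_chart_def by blast
  next
    case 2 show ?thesis using p r identities_y0[OF c 2] unfolding is_chart_def by blast
  next
    case 3 show ?thesis using p r identities_xy[OF c 3] unfolding is_chart_def by blast
  qed
qed

lemma nonvan:
  fixes q x y T W S :: complex
  assumes q: "q \<noteq> 0" and A: "y^2 \<noteq> q" and B: "x^2 \<noteq> q" and nz: "\<not> (x = 0 \<and> y = 0)"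
    and S: "T = 0 \<and> W = 1 \<and> S = 0 \<or> S = 1"
    and L: "lin1 q x y T W S = 0" "lin2 q x y T W S = 0"
  shows "quad1 q x y T W S \<noteq> 0 \<or> quad2 q x y T W S \<noteq> 0"
proof -
  consider "x = 0" "y \<noteq> 0" | "x \<noteq> 0" "y = 0" | "x \<noteq> 0" "y \<noteq> 0" using nz by blast
  then show ?thesis
  proof cases
    case 1
    have "W = 0" using L(2) 1 by (simp add: lin2_def)
    moreover from this have "T = 0" using L(1) 1 q by (simp add: lin1_def)
    ultimately have "S = 1" using S by auto
    then have "quad2 q x y T W S \<noteq> 0"
      using 1 q A \<open>T = 0\<close> by (simp add: quad2_def cof_def)
    then show ?thesis ..
  next
    case 2
    have "T + (x^2 - q) * q * S = 0"
      
    proof -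
      have "x^2 * q * (T + (x^2 - q) * q * S) = 0" using L(1) 2(2) unfolding lin1_def by algebra
      then show ?thesis using 2 q by simp
    qed
    moreover have "T - (x^2 - q) * q * S = 0"
      
    proof -
      have "x * q * (T - (x^2 - q) * q * S) = 0" using L(2) 2(2) unfolding lin2_def by algebra
      then show ?thesis using 2 q by simp
    qed
    ultimately have "2 * ((x^2 - q) * q * S) = 0" by algebra
    then have "S = 0" using q B by simp
    then have "quad2 q x y T W S \<noteq> 0" using S 2 by (auto simp: quad2_def cof_def)
    then show ?thesis ..
  next
    case 3
    show ?thesis
    proof (rule ccontr)
      assume "\<not> ?thesis"
      then have Q: "quad1 q x y T W S = 0" "quad2 q x y T W S = 0" by auto
      note Q = Q[unfolded quad_cases(5,6)[OF 3]] and L = L[unfolded lin1_def lin2_def]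
      have S1: "S = 1" using S L 3 by auto
      note Q = Q[unfolded S1 power_one mult_1_right] and L = L[unfolded S1 power_one mult_1_right]
      have "2 * (x^2-q) * (y^2 * T - x^2 * (y^2-q)^2) = 0" using L by algebra
      then have a: "y^2 * T = x^2 * (y^2-q)^2" using B by simp
      have T0: "T \<noteq> 0" using a 3 A by auto
      have b: "x * y * W = q * (x^2 + y^2) * T"
      proof -
        have "2 * (x * y * W - q * (x^2 + y^2) * T) = 0" using L by algebra
        then show ?thesis by simp
      qed
      have "2 * ((x^2-q)*(y^2-q)) * (x * y * W + q * (x^2 + y^2) * T) = 0" using Q by algebra
      then have "x * y * W + q * (x^2 + y^2) * T = 0" using A B by simp
      with b have "2 * (q * (x^2 + y^2) * T) = 0" by algebra
      then have c: "x^2 + y^2 = 0" using q T0 by simp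
      have "2 * T * (y^2-q) * (x^2 * T - y^2 * (x^2-q)^2) = 0" using Q by algebra
      then have d: "x^2 * T = y^2 * (x^2-q)^2" using T0 A by simp
      have "4 * (x^2 * x^2 * q) = 0" using a c d by algebra
      then show False using q 3 by simp
    qed
  qed
qed

lemma fwd_lin_x:
  fixes q x y u v T W :: complex
  assumes D: "(u^2-q)*(v^2-q) = (x^2-q)*(y^2-q)" and k: "v^2 \<noteq> y^2"
    and T: "T * (v-y)^2 = (y^2-q)*(v^2-q)*(u+x)^2"
    and W: "W * (v^2-y^2) = T * (2*y*u*(q-v^2) + 2*x*v*(q-y^2))"
  shows "lin1 q x y T W 1 = u * lin2 q x y T W 1"
proof -
  let ?N = "2*y*u*(q-v^2) + 2*x*v*(q-y^2)"
  let ?c = "(x^2*(y^2-q) - 2*q*y^2) + u*x*(y^2+q)"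
  have K: "y*(x^2-u^2)*?N + (?c*(x+u) - x*(u^2-q)*(v-y)^2)*(v^2-y^2) = 0"
    using D by algebra
  have "(lin1 q x y T W 1 - u * lin2 q x y T W 1) * (v^2-y^2) =
    y*(x-u)*(W*(v^2-y^2)) + ?c*T*(v^2-y^2) - x*(y^2-q)*((x^2-q)*(y^2-q))*(x+u)*(v^2-y^2)"
    unfolding lin1_def lin2_def by algebra
  also have "\<dots> = T*(y*(x-u)*?N + ?c*(v^2-y^2)) - x*(y^2-q)*((u^2-q)*(v^2-q))*(x+u)*(v^2-y^2)"
    unfolding W D by algebra
  finally have "(lin1 q x y T W 1 - u * lin2 q x y T W 1) * (v^2-y^2) * (v-y)^2 =
     (T*(v-y)^2)*(y*(x-u)*?N + ?c*(v^2-y^2)) - x*(y^2-q)*((u^2-q)*(v^2-q))*(x+u)*(v^2-y^2)*(v-y)^2"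
    by algebra
  also have "\<dots> = (y^2-q)*(v^2-q)*(u+x)*(y*(x^2-u^2)*?N + (?c*(x+u) - x*(u^2-q)*(v-y)^2)*(v^2-y^2))"
    unfolding T by algebra
  also have "\<dots> = 0" unfolding K by simp
  finally show ?thesis using k by auto
qed

lemma fwd_sym:
  fixes q x y u v T W :: complex
  assumes D: "(u^2-q)*(v^2-q) = (x^2-q)*(y^2-q)" and k: "v^2 \<noteq> y^2" and A: "y^2 \<noteq> q"  "x^2 \<noteq> q"
    and T: "T * (v-y)^2 = (y^2-q)*(v^2-q)*(u+x)^2"
    and W: "W * (v^2-y^2) = T * (2*y*u*(q-v^2) + 2*x*v*(q-y^2))"
  shows "u^2 \<noteq> x^2" "T * (u-x)^2 = (x^2-q)*(u^2-q)*(v+y)^2"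
     "(-W) * (u^2-x^2) = T * (2*x*v*(q-u^2) + 2*y*u*(q-x^2))"
proof -
  show k': "u^2 \<noteq> x^2"
  proof
    assume "u^2 = x^2"
    then have "(x^2-q)*(v^2-y^2) = 0" using D by algebra
    then show False using A k by simp
  qed
  have K: "(v^2-q)*(u^2-x^2) = -((x^2-q)*(v^2-y^2))" using D by algebra
  have w: "v^2 - q \<noteq> 0" using D A by auto
  have e: "(v^2-q)*(T * (u-x)^2 - (x^2-q)*(u^2-q)*(v+y)^2) * (v-y)^2 = 0"
  proof -
    have "(v^2-q)*(T * (u-x)^2 - (x^2-q)*(u^2-q)*(v+y)^2) * (v-y)^2
       = (v^2-q)*(T*(v-y)^2)*(u-x)^2 - (x^2-q)*((u^2-q)*(v^2-q))*(v^2-y^2)^2" by algebra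
    also have "\<dots> = (y^2-q)*((v^2-q)*(u^2-x^2))^2 - (x^2-q)*((x^2-q)*(y^2-q))*(v^2-y^2)^2"
      unfolding T D by algebra
    also have "\<dots> = 0" unfolding K by algebra
    finally show ?thesis .
  qed
  then show "T * (u-x)^2 = (x^2-q)*(u^2-q)*(v+y)^2" using w k by auto
  have "(v^2-q)*((-W) * (u^2-x^2) - T * (2*x*v*(q-u^2) + 2*y*u*(q-x^2))) =
     -W * ((v^2-q)*(u^2-x^2)) - T * (-2*x*v*((u^2-q)*(v^2-q)) + 2*y*u*(q-x^2)*(v^2-q))" by algebra
  also have "\<dots> = (x^2-q)*(W*(v^2-y^2)) - T*(-2*x*v*((x^2-q)*(y^2-q)) + 2*y*u*(q-x^2)*(v^2-q))"
    unfolding K D by algebra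
  also have "\<dots> = 0" unfolding W by algebra
  finally show "(-W) * (u^2-x^2) = T * (2*x*v*(q-u^2) + 2*y*u*(q-x^2))" using w by simp
qed

lemma fwd_curve:
  fixes q x y u v T W :: complex
  assumes D: "(u^2-q)*(v^2-q) = (x^2-q)*(y^2-q)" and k: "v^2 \<noteq> y^2"
    and T: "T * (v-y)^2 = (y^2-q)*(v^2-q)*(u+x)^2"
    and W: "W * (v^2-y^2) = T * (2*y*u*(q-v^2) + 2*x*v*(q-y^2))"
  shows "on_curve q x y T W 1"
proof -
  let ?N = "2*y*u*(q-v^2) + 2*x*v*(q-y^2)"
  let ?m = "(u^2-q)*(v^2-q)" let ?P = "(y^2-q)*(v^2-q)*(u+x)^2"
  have K: "?P*?N^2 = (?P^2 + (4*q^2-2*?m)*?P*(v-y)^2 + ?m^2*(v-y)^4)*(v+y)^2"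
    using D by algebra
  have "W^2 = T^3 + (4*q^2-2*m)*T^2 + m^2*T"
    if T: "T * (v-y)^2 = P" and W: "W * (v^2-y^2) = T * N"
      and K: "P*N^2 = (P^2 + (4*q^2-2*m)*P*(v-y)^2 + m^2*(v-y)^4)*(v+y)^2" for m N P
  proof -
    let ?r = "T^3 + (4*q^2-2*m)*T^2 + m^2*T"
    have "W^2 * ((v-y)^4*(v+y)^2) = (W*(v^2-y^2))^2*(v-y)^2" by algebra
    also have "\<dots> = T * ((T*(v-y)^2) * N^2)" unfolding W by algebra
    also have "\<dots> = T * ((P^2 + (4*q^2-2*m)*P*(v-y)^2 + m^2*(v-y)^4)*(v+y)^2)"
      unfolding T K ..
    also have "\<dots> = ?r * ((v-y)^4*(v+y)^2)" unfolding T[symmetric] by algebra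
    finally have "W^2 * ((v-y)^4*(v+y)^2) = ?r * ((v-y)^4*(v+y)^2)" .
    moreover have "(v-y)^4*(v+y)^2 \<noteq> 0" using k by (auto simp: power2_eq_iff add_eq_0_iff)
    ultimately show ?thesis by simp
  qed
  from this[OF T W K] have "W^2 = T^3 + (4*q^2-2*?m)*T^2 + ?m^2*T" .
  then show ?thesis unfolding on_curve_def D by simp
qed

lemma fwd_quad_x:
  fixes q x y u v T W :: complex
  assumes D: "(u^2-q)*(v^2-q) = (x^2-q)*(y^2-q)" and k: "v^2 \<noteq> y^2" and A: "y^2 \<noteq> q"  "x^2 \<noteq> q"
    and nz: "\<not> (x = 0 \<and> y = 0)" and q: "q \<noteq> 0"
    and T: "T * (v-y)^2 = (y^2-q)*(v^2-q)*(u+x)^2"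
    and W: "W * (v^2-y^2) = T * (2*y*u*(q-v^2) + 2*x*v*(q-y^2))"
  shows "quad1 q x y T W 1 = u * quad2 q x y T W 1"
proof -
  note lin = fwd_lin_x[OF D k T W]
  note sy = fwd_sym[OF D k A T W]
  have cv: "W^2 = T * cof q x y T 1"
    using fwd_curve[OF D k T W] unfolding on_curve_def cof_def power_one mult_1_right by algebra
  have "(v^2-q)*(u+x)^2 \<noteq> 0" using D A sy(1) by (auto simp: add_eq_0_iff)
  then have T0: "T \<noteq> 0" using T A by auto
  consider "x = 0" "y \<noteq> 0" | "x \<noteq> 0" "y = 0" | "x \<noteq> 0" "y \<noteq> 0" using nz by blast
  then show ?thesis
  proof cases
    case 1
    have "y * (u * W + 2*q*y*T) = 0" using lin 1(1) unfolding lin1_def lin2_def power_one mult_1_right by algebra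
    then have a: "u * W = -(2*q*y*T)" using 1 by (simp add: eq_neg_iff_add_eq_0)
    have "T * (u * cof q x y T 1) = (u * W) * W" using cv by algebra
    also have "\<dots> = T * (-(2*q*y*W))" unfolding a by algebra
    finally have "u * cof q x y T 1 = -(2*q*y*W)" unfolding mult_left_cancel[OF T0] .
    then show ?thesis unfolding quad_cases(1,2)[OF 1(1)] by simp
  next
    case 2
    have "x * q * (x * (T + (x^2-q)*q) - u * (T - (x^2-q)*q)) = 0"
      using lin 2(2) unfolding lin1_def lin2_def power_one mult_1_right by algebra
    then have "x * (T + (x^2-q)*q) = u * (T - (x^2-q)*q)" using 2 q by simp
    then show ?thesis unfolding quad_cases(3,4)[OF 2] power_one mult_1_right using cv 2(2) by algebra
  next
    case 3
    let ?m = "(x^2-q)*(y^2-q)"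
    define T' where "T' = ?m^2 / T"
    define W' where "W' = -(?m^2 * W) / T^2"
    have T': "T * T' = ?m^2" and W': "T^2 * W' = -(?m^2 * W)"
      using T0 by (auto simp: T'_def W'_def)
    have "T * (T' * (-v-y)^2) = T * ((y^2-q)*((-v)^2-q)*(-u+x)^2)"
    proof -
      have "T * (T' * (-v-y)^2) = (T*T')*(v+y)^2" by algebra
      also have "\<dots> = (y^2-q) * (x^2-q) * ((x^2-q)*(y^2-q)) * (v+y)^2" unfolding T' by algebra
      also have "\<dots> = (y^2-q) * (v^2-q) * ((x^2-q) * (u^2-q) * (v+y)^2)"
        unfolding D[symmetric] by algebra
      also have "\<dots> = T * ((y^2-q)*((-v)^2-q)*(-u+x)^2)" unfolding sy(2)[symmetric] by algebra
      finally show ?thesis .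
    qed
    then have a: "T' * (-v-y)^2 = (y^2-q)*((-v)^2-q)*(-u+x)^2" using T0 by simp
    have "T^2 * (W' * ((-v)^2-y^2)) = T^2 * (T' * (2*y*(-u)*(q-(-v)^2) + 2*x*(-v)*(q-y^2)))"
    proof -
      have "T^2 * (W' * ((-v)^2-y^2)) = (T^2 * W') * (v^2-y^2)" by algebra
      also have "\<dots> = -(?m^2) * (W * (v^2-y^2))" unfolding W' by algebra
      also have "\<dots> = -(T * T') * (T * (2*y*u*(q-v^2) + 2*x*v*(q-y^2)))" unfolding W T' ..
      also have "\<dots> = T^2 * (T' * (2*y*(-u)*(q-(-v)^2) + 2*x*(-v)*(q-y^2)))" by algebra
      finally show ?thesis .
    qed
    then have b: "W' * ((-v)^2-y^2) = T' * (2*y*(-u)*(q-(-v)^2) + 2*x*(-v)*(q-y^2))" using T0 by simp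
    have c: "lin1 q x y T' W' 1 = (-u) * lin2 q x y T' W' 1"
      using D k by (intro fwd_lin_x[OF _ _ a b]) simp_all
    have d: "T^2 * lin1 q x y T' W' 1 = -(?m * quad1 q x y T W 1)"
    proof -
      have "T^2 * lin1 q x y T' W' 1 = x*y*(T^2*W') + (x^2*(y^2-q) - 2*q*y^2)*T*(T*T') - x^2*(y^2-q)*?m*T^2"
        unfolding lin1_def power_one mult_1_right by algebra
      also have "\<dots> = -(?m * quad1 q x y T W 1)" unfolding T' W' quad_cases(5,6)[OF 3] power_one mult_1_right by algebra
      finally show ?thesis .
    qed
    have e: "T^2 * lin2 q x y T' W' 1 = ?m * quad2 q x y T W 1"
    proof -
      have "T^2 * lin2 q x y T' W' 1 = y*(T^2*W') - x*(y^2+q)*T*(T*T') + x*(y^2-q)*?m*T^2"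
        unfolding lin2_def power_one mult_1_right by algebra
      also have "\<dots> = ?m * quad2 q x y T W 1" unfolding T' W' quad_cases(5,6)[OF 3] power_one mult_1_right by algebra
      finally show ?thesis .
    qed
    have "?m * quad1 q x y T W 1 = ?m * (u * quad2 q x y T W 1)"
      using c d e by algebra
    then show ?thesis using A by simp
  qed
qed

lemma f_map_eq:
  fixes q x y u v :: complex
  assumes D: "(u^2-q)*(v^2-q) = (x^2-q)*(y^2-q)" and k: "v^2 \<noteq> y^2"
  shows "f_map q x y u v = Affine T W \<longleftrightarrow>
     T * (v-y)^2 = (y^2-q)*(v^2-q)*(u+x)^2 \<and>
     W * (v^2-y^2) = T * (2*y*u*(q-v^2) + 2*x*v*(q-y^2))"
proof -
  have n: "2*x*(v^2-q)*u + (x^2+q)*v^2 + x^2*y^2 - 2*x^2*q - y^2*q = (v^2-q)*(u+x)^2"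
    using D by algebra
  have z: "(v-y)^2 \<noteq> 0" "v^2-y^2 \<noteq> 0" using k by auto
  have "f_map q x y u v = Affine T W \<longleftrightarrow>
      T = (y^2-q)*(v^2-q)*(u+x)^2 / (v-y)^2 \<and>
      W = T * (2*y*u*(q-v^2) + 2*x*v*(q-y^2)) / (v^2-y^2)"
    unfolding f_map_def n Let_def by (auto simp: mult.assoc)
  then show ?thesis using z by (simp add: eq_divide_eq)
qed

definition x_chart :: "complex \<Rightarrow> complex \<Rightarrow> complex \<Rightarrow> ec_point \<Rightarrow> complex \<times> complex" where
  "x_chart q x y P = (case hcoords P of (T, W, S) \<Rightarrow>
     if lin1 q x y T W S = 0 \<and> lin2 q x y T W S = 0
     then (quad1 q x y T W S, quad2 q x y T W S) else (lin1 q x y T W S, lin2 q x y T W S))"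

definition y_chart :: "complex \<Rightarrow> complex \<Rightarrow> complex \<Rightarrow> ec_point \<Rightarrow> complex \<times> complex" where
  "y_chart q x y P = (case hcoords P of (T, W, S) \<Rightarrow>
     if lin1 q y x T (-W) S = 0 \<and> lin2 q y x T (-W) S = 0
     then (quad1 q y x T (-W) S, quad2 q y x T (-W) S)
     else (lin1 q y x T (-W) S, lin2 q y x T (-W) S))"

definition explicit_inverse ::
  "complex \<Rightarrow> complex \<Rightarrow> complex \<Rightarrow> ec_point \<Rightarrow> complex \<times> complex \<times> complex" where
  "explicit_inverse q x y P = (case x_chart q x y P of (p1, p2) \<Rightarrow> case y_chart q x y P of (r1, r2) \<Rightarrow>
     (p1 * r2, p2 * r1, p2 * r2))"

lemma rat_form_cmult: "c \<in> \<rat> \<Longrightarrow> rat_form d F \<Longrightarrow> rat_form d (\<lambda>T W S. c * F T W S)"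
  using rat_form.mult[OF rat_form.const, of c d F] by simp

lemma rat_form_uminus: "rat_form d F \<Longrightarrow> rat_form d (\<lambda>T W S. - F T W S)"
  using rat_form_cmult[of "-1" d F] by simp

lemma rat_form_diff:
  "rat_form d F \<Longrightarrow> rat_form d G \<Longrightarrow> rat_form d (\<lambda>T W S. F T W S - G T W S)"
  using rat_form.add[OF _ rat_form_uminus, of d F G] by simp

lemma rat_form_quadratic:
  assumes "a \<in> \<rat>" "b \<in> \<rat>" "c \<in> \<rat>" "d \<in> \<rat>" "e \<in> \<rat>"
  shows "rat_form 2 (\<lambda>T W S. a*(T*T) + b*(W*W) + c*(T*S) + d*(W*S) + e*(S*S))"
  using assms rat_form.mult[OF rat_form.var1 rat_form.var1] rat_form.mult[OF rat_form.var2 rat_form.var2]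
    rat_form.mult[OF rat_form.var1 rat_form.var3] rat_form.mult[OF rat_form.var2 rat_form.var3]
    rat_form.mult[OF rat_form.var3 rat_form.var3]
  by (intro rat_form.add rat_form_cmult) (simp_all add: numeral_2_eq_2)

lemma rat_form_linear:
  assumes "a \<in> \<rat>" "b \<in> \<rat>" "c \<in> \<rat>"
  shows "rat_form 1 (\<lambda>T W S. a*T + b*W + c*S)"
  using assms by (intro rat_form.add rat_form_cmult rat_form.var1 rat_form.var2 rat_form.var3)

lemma rat_form_lin:
  assumes "q \<in> \<rat>" "x \<in> \<rat>" "y \<in> \<rat>" "s \<in> \<rat>"
  shows "rat_form 1 (\<lambda>T W S. lin1 q x y T (s*W) S)" "rat_form 1 (\<lambda>T W S. lin2 q x y T (s*W) S)"
proof -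
  have "(\<lambda>T W S. lin1 q x y T (s*W) S) = (\<lambda>T W S. (x^2*(y^2-q) - 2*q*y^2)*T + (x*y*s)*W +
      (-(x^2*(y^2-q)*((x^2-q)*(y^2-q))))*S)"
    by (intro ext) (simp add: lin1_def)
  then show "rat_form 1 (\<lambda>T W S. lin1 q x y T (s*W) S)"
    using assms by (simp only:) (intro rat_form_linear, auto)
  have "(\<lambda>T W S. lin2 q x y T (s*W) S) = (\<lambda>T W S. (-(x*(y^2+q)))*T + (y*s)*W +
      (x*(y^2-q)*((x^2-q)*(y^2-q)))*S)"
    by (intro ext) (simp add: lin2_def)
  then show "rat_form 1 (\<lambda>T W S. lin2 q x y T (s*W) S)"
    using assms by (simp only:) (intro rat_form_linear, auto)
qed

lemma rat_form_quad:
  assumes "q \<in> \<rat>" "x \<in> \<rat>" "y \<in> \<rat>" "s \<in> \<rat>"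
  shows "rat_form 2 (\<lambda>T W S. quad1 q x y T (s*W) S)" (is ?A)
    "rat_form 2 (\<lambda>T W S. quad2 q x y T (s*W) S)" (is ?B)
proof -
  let ?m = "(x^2-q)*(y^2-q)"
  have "?A \<and> ?B"
  proof -
    consider "x = 0" | "x \<noteq> 0" "y = 0" | "x \<noteq> 0" "y \<noteq> 0" by blast
    then show ?thesis
    proof cases
      case 1
      have e1: "(\<lambda>T W S. quad1 q x y T (s*W) S) =
          (\<lambda>T W S. 0*(T*T) + 0*(W*W) + 0*(T*S) + (-(2*q*y*s))*(W*S) + 0*(S*S))"
        unfolding quad_cases(1,2)[OF 1] by (intro ext) simp
      have e2: "(\<lambda>T W S. quad2 q x y T (s*W) S) =
          (\<lambda>T W S. 1*(T*T) + 0*(W*W) + (4*q^2 - 2*?m)*(T*S) + 0*(W*S) + ?m^2*(S*S))"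
        unfolding quad_cases(1,2)[OF 1] cof_def by (intro ext) (simp add: power2_eq_square)
      show ?thesis unfolding e1 e2 using assms by (intro conjI rat_form_quadratic) auto
    next
      case 2
      have e1: "(\<lambda>T W S. quad1 q x y T (s*W) S) =
          (\<lambda>T W S. (-(x*?m))*(T*T) + (x*s^2)*(W*W) + (-(x*?m*(4*q^2 - 2*?m)))*(T*S) + 0*(W*S)
             + (-(x*?m*?m^2))*(S*S))"
        unfolding quad_cases(3,4)[OF 2] cof_def by (intro ext) (algebra)
      have e2: "(\<lambda>T W S. quad2 q x y T (s*W) S) =
          (\<lambda>T W S. ?m*(T*T) + s^2*(W*W) + (?m*(4*q^2 - 2*?m))*(T*S) + 0*(W*S) + (?m*?m^2)*(S*S))"
        unfolding quad_cases(3,4)[OF 2] cof_def by (intro ext) (algebra)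
      show ?thesis unfolding e1 e2 using assms by (intro conjI rat_form_quadratic) auto
    next
      case 3
      have e1: "(\<lambda>T W S. quad1 q x y T (s*W) S) =
          (\<lambda>T W S. (x^2*(y^2-q))*(T*T) + 0*(W*W) + (-((x^2*(y^2-q) - 2*q*y^2)*?m))*(T*S)
             + (x*y*?m*s)*(W*S) + 0*(S*S))"
        unfolding quad_cases(5,6)[OF 3] by (intro ext) (simp add: power2_eq_square)
      have e2: "(\<lambda>T W S. quad2 q x y T (s*W) S) =
          (\<lambda>T W S. (x*(y^2-q))*(T*T) + 0*(W*W) + (-(x*(y^2+q)*?m))*(T*S) + (-(y*?m*s))*(W*S) + 0*(S*S))"
        unfolding quad_cases(5,6)[OF 3] by (intro ext) (simp add: power2_eq_square)
      show ?thesis unfolding e1 e2 using assms by (intro conjI rat_form_quadratic) auto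
    qed
  qed
  then show ?A ?B by blast+
qed

lemma proportional:
  fixes a b a' b' :: complex
  assumes "a * b' = b * a'" "a \<noteq> 0 \<or> b \<noteq> 0" "a' \<noteq> 0 \<or> b' \<noteq> 0"
  shows "\<exists>c. c \<noteq> 0 \<and> a = c * a' \<and> b = c * b'"
proof (cases "a' = 0")
  case True
  then have "b' \<noteq> 0" "a = 0" "b \<noteq> 0" using assms by auto
  then show ?thesis using True by (intro exI[of _ "b / b'"]) simp
next
  case False
  then have "a \<noteq> 0" using assms by auto
  then show ?thesis using False assms(1) by (intro exI[of _ "a / a'"]) (auto simp: field_simps)
qed

locale quartic_with_point =
  fixes q m x1 y1 :: complex
  assumes rat: "q \<in> \<rat>" "x1 \<in> \<rat>" "y1 \<in> \<rat>"
    and q0: "q \<noteq> 0" and m0: "m \<noteq> 0" and mq: "m \<noteq> q^2"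
    and base: "(x1, y1) \<in> quartic q m"
begin

lemma m_eq: "(x1^2 - q) * (y1^2 - q) = m" and m_eq': "(y1^2 - q) * (x1^2 - q) = m"
  using base by (simp_all add: quartic_def mult.commute)

lemma x1q: "x1^2 \<noteq> q" and y1q: "y1^2 \<noteq> q" using m_eq m0 by auto

lemma nz: "\<not> (x1 = 0 \<and> y1 = 0)" "\<not> (y1 = 0 \<and> x1 = 0)"
  using m_eq mq by (auto simp: power2_eq_square)

lemma hcoords_on_curve:
  assumes "P \<in> ec q m" "hcoords P = (T, W, S)"
  shows "on_curve q x1 y1 T W S" "on_curve q y1 x1 T (-W) S"
    "T = 0 \<and> W = 1 \<and> S = 0 \<or> S = 1"
proof -
  have "W^2*S = T^3 + (4*q^2 - 2*m)*T^2*S + m^2*T*S^2 \<and> (T = 0 \<and> W = 1 \<and> S = 0 \<or> S = 1)"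
    using assms by (auto simp: ec_def)
  then show "on_curve q x1 y1 T W S" "on_curve q y1 x1 T (-W) S"
    "T = 0 \<and> W = 1 \<and> S = 0 \<or> S = 1"
    by (auto simp: on_curve_def m_eq m_eq')
qed

lemma quad_nonzero:
  assumes "P \<in> ec q m" "hcoords P = (T, W, S)"
  shows "lin1 q x1 y1 T W S = 0 \<Longrightarrow> lin2 q x1 y1 T W S = 0 \<Longrightarrow>
      quad1 q x1 y1 T W S \<noteq> 0 \<or> quad2 q x1 y1 T W S \<noteq> 0"
    "lin1 q y1 x1 T (-W) S = 0 \<Longrightarrow> lin2 q y1 x1 T (-W) S = 0 \<Longrightarrow>
      quad1 q y1 x1 T (-W) S \<noteq> 0 \<or> quad2 q y1 x1 T (-W) S \<noteq> 0"
proof -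
  show "quad1 q x1 y1 T W S \<noteq> 0 \<or> quad2 q x1 y1 T W S \<noteq> 0"
    if "lin1 q x1 y1 T W S = 0" "lin2 q x1 y1 T W S = 0"
    by (rule nonvan[OF q0 y1q x1q nz(1) hcoords_on_curve(3)[OF assms] that])
  show "quad1 q y1 x1 T (-W) S \<noteq> 0 \<or> quad2 q y1 x1 T (-W) S \<noteq> 0"
    if L: "lin1 q y1 x1 T (-W) S = 0" "lin2 q y1 x1 T (-W) S = 0"
  proof (cases "S = 1")
    case True
    then show ?thesis using nonvan[OF q0 x1q y1q nz(2) _ L] by auto
  next
    case False
    then have z: "T = 0" "W = 1" "S = 0" using hcoords_on_curve(3)[OF assms] by auto
    have "lin1 q y1 x1 0 1 0 = 0" "lin2 q y1 x1 0 1 0 = 0"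
      using L unfolding z by (auto simp: lin1_def lin2_def)
    from nonvan[OF q0 x1q y1q nz(2) _ this]
    show ?thesis unfolding z quad1_def quad2_def cof_def by (auto split: if_splits)
  qed
qed

lemma charts_at:
  assumes P: "P \<in> ec q m" and h: "hcoords P = (T, W, S)"
    and p: "x_chart q x1 y1 P = (p1, p2)" and r: "y_chart q x1 y1 P = (r1, r2)"
  shows "is_chart q x1 y1 T W S p1 p2" "is_chart q y1 x1 T (-W) S r1 r2"
    "p1 \<noteq> 0 \<or> p2 \<noteq> 0" "r1 \<noteq> 0 \<or> r2 \<noteq> 0" "p2 \<noteq> 0 \<or> r2 \<noteq> 0"
    "identities q x1 y1 T W S p1 p2 r1 r2"
proof -
  show a: "is_chart q x1 y1 T W S p1 p2" "is_chart q y1 x1 T (-W) S r1 r2"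
    using p r by (auto simp: x_chart_def y_chart_def h is_chart_def split: if_splits)
  show b: "p1 \<noteq> 0 \<or> p2 \<noteq> 0" "r1 \<noteq> 0 \<or> r2 \<noteq> 0"
    using p r quad_nonzero[OF P h] by (auto simp: x_chart_def y_chart_def h split: if_splits)
  show i: "identities q x1 y1 T W S p1 p2 r1 r2"
    by (rule chart_identities[OF hcoords_on_curve(1)[OF P h] nz(1) a])
  show "p2 \<noteq> 0 \<or> r2 \<noteq> 0"
  proof (rule ccontr)
    assume "\<not> ?thesis"
    with i b show False by (simp add: identities_def)
  qed
qed

lemma explicit_inverse_in_closure:
  assumes P: "P \<in> ec q m"
  shows "explicit_inverse q x1 y1 P \<in> quartic_closure q m"
proof -
  obtain T W S p1 p2 r1 r2 where h: "hcoords P = (T, W, S)"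
    and p: "x_chart q x1 y1 P = (p1, p2)" and r: "y_chart q x1 y1 P = (r1, r2)"
    by (metis prod.exhaust)
  note c = charts_at[OF P h p r]
  have "((p1*r2)^2 - q*(p2*r2)^2) * ((p2*r1)^2 - q*(p2*r2)^2) =
      ((p1^2 - q*p2^2) * (r1^2 - q*r2^2)) * (p2^2*r2^2)" by algebra
  also have "\<dots> = m * (p2*r2)^4"
    using c(6)[unfolded identities_def m_eq, THEN conjunct1] by algebra
  finally show ?thesis using c(3-5)
    unfolding explicit_inverse_def quartic_closure_def p r by auto
qed

lemma explicit_inverse_locally_forms:
  assumes P: "P \<in> ec q m"
  shows "\<exists>d F G H. rat_form d F \<and> rat_form d G \<and> rat_form d H \<and>
        eval_forms F G H P \<noteq> (0, 0, 0) \<and>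
        (\<forall>Q\<in>ec q m. eval_forms F G H Q \<noteq> (0, 0, 0) \<longrightarrow>
           proj_eq (explicit_inverse q x1 y1 Q) (eval_forms F G H Q))"
proof -
  obtain T W S p1 p2 r1 r2 where h: "hcoords P = (T, W, S)"
    and p: "x_chart q x1 y1 P = (p1, p2)" and r: "y_chart q x1 y1 P = (r1, r2)"
    by (metis prod.exhaust)
  note cP = charts_at[OF P h p r]
  have "\<exists>d F1 F2. rat_form d F1 \<and> rat_form d F2 \<and> F1 T W S = p1 \<and> F2 T W S = p2 \<and>
      (\<forall>T W S. is_chart q x1 y1 T W S (F1 T W S) (F2 T W S))"
  proof (cases "p1 = lin1 q x1 y1 T W S \<and> p2 = lin2 q x1 y1 T W S")
    case True
    show ?thesis
      by (rule exI[of _ 1], rule exI[of _ "lin1 q x1 y1"], rule exI[of _ "lin2 q x1 y1"])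
         (use True rat_form_lin[OF rat, of 1] in \<open>simp add: is_chart_def\<close>)
  next
    case False
    show ?thesis
      by (rule exI[of _ 2], rule exI[of _ "quad1 q x1 y1"], rule exI[of _ "quad2 q x1 y1"])
         (use False cP(1) rat_form_quad[OF rat, of 1] in \<open>auto simp add: is_chart_def\<close>)
  qed
  then obtain d F1 F2 where F: "rat_form d F1" "rat_form d F2" "F1 T W S = p1" "F2 T W S = p2"
    "\<And>T W S. is_chart q x1 y1 T W S (F1 T W S) (F2 T W S)" by blast
  have "\<exists>e G1 G2. rat_form e G1 \<and> rat_form e G2 \<and> G1 T W S = r1 \<and> G2 T W S = r2 \<and>
      (\<forall>T W S. is_chart q y1 x1 T (-W) S (G1 T W S) (G2 T W S))"
  proof (cases "r1 = lin1 q y1 x1 T (-W) S \<and> r2 = lin2 q y1 x1 T (-W) S")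
    case True
    show ?thesis
      by (rule exI[of _ 1], rule exI[of _ "\<lambda>T W S. lin1 q y1 x1 T (-W) S"],
          rule exI[of _ "\<lambda>T W S. lin2 q y1 x1 T (-W) S"])
         (use True rat_form_lin[OF rat(1,3,2), of "-1"] in \<open>simp add: is_chart_def\<close>)
  next
    case False
    show ?thesis
      by (rule exI[of _ 2], rule exI[of _ "\<lambda>T W S. quad1 q y1 x1 T (-W) S"],
          rule exI[of _ "\<lambda>T W S. quad2 q y1 x1 T (-W) S"])
         (use False cP(2) rat_form_quad[OF rat(1,3,2), of "-1"] in \<open>auto simp add: is_chart_def\<close>)
  qed
  then obtain e G1 G2 where G: "rat_form e G1" "rat_form e G2" "G1 T W S = r1" "G2 T W S = r2"
    "\<And>T W S. is_chart q y1 x1 T (-W) S (G1 T W S) (G2 T W S)" by blast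
  let ?X = "\<lambda>T W S. F1 T W S * G2 T W S" let ?Y = "\<lambda>T W S. F2 T W S * G1 T W S"
  let ?Z = "\<lambda>T W S. F2 T W S * G2 T W S"
  have "proj_eq (explicit_inverse q x1 y1 Q) (eval_forms ?X ?Y ?Z Q)"
    if Q: "Q \<in> ec q m" and ne: "eval_forms ?X ?Y ?Z Q \<noteq> (0, 0, 0)" for Q
  proof -
    obtain T W S p1 p2 r1 r2 where h: "hcoords Q = (T, W, S)"
      and p: "x_chart q x1 y1 Q = (p1, p2)" and r: "y_chart q x1 y1 Q = (r1, r2)"
      by (metis prod.exhaust)
    note c = charts_at[OF Q h p r] and on = hcoords_on_curve[OF Q h]
    have ne': "F1 T W S \<noteq> 0 \<or> F2 T W S \<noteq> 0" "G1 T W S \<noteq> 0 \<or> G2 T W S \<noteq> 0"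
      using ne by (auto simp: eval_forms_def h)
    have "p1 * F2 T W S = p2 * F1 T W S"
      using c(1) F(5)[of T W S] chart_compat[OF on(1) nz(1)]
      unfolding is_chart_def by (auto simp: mult.commute)
    from proportional[OF this c(3) ne'(1)] obtain a
      where a: "a \<noteq> 0" "p1 = a * F1 T W S" "p2 = a * F2 T W S" by blast
    have "r1 * G2 T W S = r2 * G1 T W S"
      using c(2) G(5)[of T W S] chart_compat[OF on(2) nz(2)]
      unfolding is_chart_def by (auto simp: mult.commute)
    from proportional[OF this c(4) ne'(2)] obtain b
      where b: "b \<noteq> 0" "r1 = b * G1 T W S" "r2 = b * G2 T W S" by blast
    show ?thesis unfolding proj_eq_def explicit_inverse_def eval_forms_def h p r
      using a b by (auto intro!: exI[of _ "a * b"])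
  qed
  moreover have "eval_forms ?X ?Y ?Z P \<noteq> (0, 0, 0)"
    using cP(3-5) F(3,4) G(3,4) by (auto simp: eval_forms_def h)
  moreover have "rat_form (d + e) ?X" "rat_form (d + e) ?Y" "rat_form (d + e) ?Z"
    using F(1,2) G(1,2) by (auto intro: rat_form.mult)
  ultimately show ?thesis by blast
qed

lemma explicit_inverse_left:
  assumes D: "(u, v) \<in> quartic q m" and k: "v^2 \<noteq> y1^2"
  shows "f_map q x1 y1 u v \<in> ec q m"
    "proj_eq (explicit_inverse q x1 y1 (f_map q x1 y1 u v)) (u, v, 1)"
proof -
  have D: "(u^2-q)*(v^2-q) = (x1^2-q)*(y1^2-q)" using D by (simp add: quartic_def m_eq)
  have D': "(v^2-q)*(u^2-q) = (y1^2-q)*(x1^2-q)" using D by (simp add: mult.commute)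
  obtain T W where f: "f_map q x1 y1 u v = Affine T W" by (simp add: f_map_def Let_def)
  then have T: "T * (v-y1)^2 = (y1^2-q)*(v^2-q)*(u+x1)^2"
    and W: "W * (v^2-y1^2) = T * (2*y1*u*(q-v^2) + 2*x1*v*(q-y1^2))"
    using f_map_eq[OF D k] by auto
  have oc: "on_curve q x1 y1 T W 1" by (rule fwd_curve[OF D k T W])
  show E: "f_map q x1 y1 u v \<in> ec q m" using oc by (simp add: f ec_def on_curve_def m_eq)
  note sy = fwd_sym[OF D k y1q x1q T W]
  obtain p1 p2 r1 r2 where p: "x_chart q x1 y1 (f_map q x1 y1 u v) = (p1, p2)"
    and r: "y_chart q x1 y1 (f_map q x1 y1 u v) = (r1, r2)" by (metis prod.exhaust)
  have h: "hcoords (f_map q x1 y1 u v) = (T, W, 1)" by (simp add: f)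
  note c = charts_at[OF E h p r]
  have 1: "p1 = u * p2"
    using c(1) fwd_lin_x[OF D k T W] fwd_quad_x[OF D k y1q x1q nz(1) q0 T W]
    unfolding is_chart_def by auto
  have 2: "r1 = v * r2"
    using c(2) fwd_lin_x[OF D' sy(1,2,3)] fwd_quad_x[OF D' sy(1) x1q y1q nz(2) q0 sy(2,3)]
    unfolding is_chart_def by auto
  have "p2 \<noteq> 0" "r2 \<noteq> 0" using c(3,4) 1 2 by auto
  then show "proj_eq (explicit_inverse q x1 y1 (f_map q x1 y1 u v)) (u, v, 1)"
    unfolding proj_eq_def explicit_inverse_def p r using 1 2
    by (auto intro!: exI[of _ "p2 * r2"])
qed

lemma explicit_inverse_right:
  assumes P: "P \<in> ec q m" and e: "proj_eq (explicit_inverse q x1 y1 P) (u, v, 1)"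
    and k: "v^2 \<noteq> y1^2"
  shows "f_map q x1 y1 u v = P"
proof -
  obtain T W S p1 p2 r1 r2 where h: "hcoords P = (T, W, S)"
    and p: "x_chart q x1 y1 P = (p1, p2)" and r: "y_chart q x1 y1 P = (r1, r2)"
    by (metis prod.exhaust)
  note c = charts_at[OF P h p r]
  from e have e: "p2 * r2 \<noteq> 0" "p1 * r2 = p2 * r2 * u" "p2 * r1 = p2 * r2 * v"
    unfolding proj_eq_def explicit_inverse_def p r by auto
  then have uv: "p1 = u * p2" "r1 = v * r2" by auto
  note i = c(6)[unfolded identities_def uv]
  note i1 = i[THEN conjunct1] and i2 = i[THEN conjunct2, THEN conjunct1]
    and i3 = i[THEN conjunct2, THEN conjunct2]
  have "((u^2-q)*(v^2-q)) * (p2^2*r2^2) = ((x1^2-q)*(y1^2-q)) * (p2^2*r2^2)" using i1 by algebra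
  then have D: "(u^2-q)*(v^2-q) = (x1^2-q)*(y1^2-q)" using e by simp
  have "(T * (v-y1)^2) * (p2^2*r2^2) = ((y1^2-q)*(v^2-q)*(u+x1)^2*S) * (p2^2*r2^2)"
    using i2 by algebra
  then have T: "T * (v-y1)^2 = (y1^2-q)*(v^2-q)*(u+x1)^2*S" using e by simp
  have "(W * (v^2-y1^2)) * (p2*r2^2) =
      (T * (2*y1*u*(q-v^2) + 2*x1*v*(q-y1^2))) * (p2*r2^2)"
    using i3 by algebra
  then have W: "W * (v^2-y1^2) = T * (2*y1*u*(q-v^2) + 2*x1*v*(q-y1^2))" using e by simp
  show ?thesis
  proof (cases P)
    case Infty
    then show ?thesis using h W k by simp
  next
    case (Affine T' W')
    then show ?thesis using h T W f_map_eq[OF D k] by simp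
  qed
qed

lemma inverse_morphism_explicit: "inverse_morphism q m x1 y1 (explicit_inverse q x1 y1)"
  unfolding inverse_morphism_def morphism_def
  using explicit_inverse_in_closure explicit_inverse_locally_forms explicit_inverse_left
    explicit_inverse_right by blast

lemma inverse_morphism_f_inv: "inverse_morphism q m x1 y1 (f_inv q m x1 y1)"
  unfolding f_inv_def using someI[of "inverse_morphism q m x1 y1", OF inverse_morphism_explicit] .

end

end

(*
  Put u = x/z and v = y/z at the image of P = (T, W) under the inverse map.  Then
  T (v - y1)^2 = (y1^2 - q)(v^2 - q)(u + x1)^2 and (x1^2 - q)(y1^2 - q) = (u^2 - q)(v^2 - q) = m,
  so g(P) = (x1^2 - q)(u^2 - q) agrees with T up to squares.  The map P -> T modulo squares is the
  descent homomorphism of the 2-isogeny with kernel {O, (0, 0)}: three collinear points satisfy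
  T1 T2 T3 = n^2, where n is the intercept of their line.

  The inverse map is only given as some morphism; it agrees with the explicit one off finitely many
  points, hence everywhere, because a form vanishing at all but finitely many points of the curve
  vanishes on the curve by continuity.
*)

theory Submission
  imports Defs "HOL-Computational_Algebra.Polynomial"
begin

section \<open>Uniqueness of the inverse morphism\<close>

lemma rat_form_tendsto:
  assumes "rat_form d F" "(t \<longlongrightarrow> T) \<F>" "(w \<longlongrightarrow> W) \<F>" "(s \<longlongrightarrow> S) \<F>"
  shows "((\<lambda>z. F (t z) (w z) (s z)) \<longlongrightarrow> F T W S) \<F>"
  using assms(1) by induction (auto intro: tendsto_intros assms)

lemma rat_form_homogeneous:
  assumes "rat_form d F"
  shows "F (k * T) (k * W) (k * S) = k ^ d * F T W S"
  using assms by induction (auto simp: algebra_simps power_add)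

text \<open>Square roots on the curve are controlled only through their squares; this yields their
  limits without a continuous branch of \<open>csqrt\<close>.\<close>

lemma tendsto_if_square_tendsto:
  fixes w c :: "'a \<Rightarrow> complex"
  assumes "(c \<longlongrightarrow> 0) \<F>" and "\<And>z. norm (w z - W) ^ 2 \<le> norm (c z)"
  shows "(w \<longlongrightarrow> W) \<F>"
proof -
  have "((\<lambda>z. sqrt (norm (c z))) \<longlongrightarrow> sqrt (norm (0::complex))) \<F>"
    by (intro tendsto_intros assms(1))
  then have lim: "((\<lambda>z. sqrt (norm (c z))) \<longlongrightarrow> 0) \<F>" by simp
  have le: "\<forall>\<^sub>F z in \<F>. norm (w z - W) \<le> sqrt (norm (c z))"
    using assms(2) by (intro always_eventually allI real_le_rsqrt)
  have "((\<lambda>z. norm (w z - W)) \<longlongrightarrow> 0) \<F>"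
    by (rule tendsto_sandwich[OF _ le tendsto_const lim]) simp
  then show ?thesis by (rule LIM_zero_cancel[OF tendsto_norm_zero_cancel])
qed

text \<open>No point of the curve is isolated: \<open>T\<close> can be varied injectively, with a
  square root supplying \<open>W\<close>. The factor \<open>k\<close> rescales [t : w : 1] so that
  the coordinates converge at infinity too.\<close>

lemma curve_approach:
  assumes P: "P \<in> ec q m" and h: "hcoords P = (T0, W0, S0)"
  obtains t w k :: "complex \<Rightarrow> complex" where
    "\<forall>z. Affine (t z) (w z) \<in> ec q m"
    "\<forall>B. finite B \<longrightarrow> (\<forall>\<^sub>F z in at 0. t z \<notin> B)"
    "((\<lambda>z. k z * t z) \<longlongrightarrow> T0) (at 0)" "((\<lambda>z. k z * w z) \<longlongrightarrow> W0) (at 0)"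
    "(k \<longlongrightarrow> S0) (at 0)"
proof (cases P)
  case Infty
  define A where "A = 4 * q^2 - 2 * m"
  define c where "c = (\<lambda>T. T^3 + A * T^2 + m^2 * T)"
  \<comment> \<open>With t = 1/z the cubic grows like z^(-3), so in [t/w : 1 : 1/w] the squares of
    the outer coordinates behave like z and z^3. This dictates the scaling k = 1/w.\<close>
  define t where "t = (\<lambda>z::complex. 1 / z)"
  define w where "w = (\<lambda>z. csqrt (c (t z)))"
  have cz: "c (t z) = (1 + A * z + m^2 * z^2) / z^3" if "z \<noteq> 0" for z
    using that by (simp add: c_def t_def field_simps power2_eq_square power3_eq_cube)
  have w2: "(w z)^2 = c (t z)" for z by (simp add: w_def)
  have lim: "((\<lambda>z. z^n / (1 + A * z + m^2 * z^2)) \<longlongrightarrow> 0) (at 0)" if "n > 0" for n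
  proof -
    have "((\<lambda>z. z^n / (1 + A * z + m^2 * z^2)) \<longlongrightarrow> 0^n / (1 + A * 0 + m^2 * 0^2)) (at 0)"
      by (intro tendsto_intros) auto
    then show ?thesis using that by (simp add: power_0_left)
  qed
  have ev0: "\<forall>\<^sub>F z in at 0. z \<noteq> (0::complex)" by (simp add: eventually_at_filter)
  have lim1: "((\<lambda>z. 1 / c (t z)) \<longlongrightarrow> 0) (at 0)"
    by (rule Lim_transform_eventually[OF lim[of 3]])
       (use ev0 in \<open>auto elim!: eventually_mono simp: cz\<close>)
  have "(t z)^2 / c (t z) = z^1 / (1 + A * z + m^2 * z^2)" if "z \<noteq> 0" for z
    unfolding cz[OF that] using that by (simp add: t_def power2_eq_square power3_eq_cube)
  then have lim2: "((\<lambda>z. (t z)^2 / c (t z)) \<longlongrightarrow> 0) (at 0)"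
    by (intro Lim_transform_eventually[OF lim[of 1]])
       (use ev0 in \<open>auto elim!: eventually_mono\<close>)
  \<comment> \<open>Where \<open>w z = 0\<close>, division by zero makes both sides of the bound 0,
    so it holds for every z.\<close>
  have k0: "((\<lambda>z. 1 / w z) \<longlongrightarrow> 0) (at 0)"
    by (rule tendsto_if_square_tendsto[OF lim1])
       (simp only: w2[symmetric] norm_divide norm_power power_divide norm_one diff_0_right power_one order_refl norm_mult power_mult_distrib times_divide_eq_left mult_1_left)
  have kt: "((\<lambda>z. 1 / w z * t z) \<longlongrightarrow> 0) (at 0)"
    by (rule tendsto_if_square_tendsto[OF lim2])
       (simp only: w2[symmetric] norm_divide norm_power power_divide norm_one diff_0_right power_one order_refl norm_mult power_mult_distrib times_divide_eq_left mult_1_left)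
  have "((\<lambda>z. 1 + A * z + m^2 * z^2) \<longlongrightarrow> 1 + A * 0 + m^2 * 0^2) (at 0)"
    by (intro tendsto_intros)
  then have "\<forall>\<^sub>F z in at 0. 1 + A * z + m^2 * z^2 \<noteq> 0"
    by (rule tendsto_imp_eventually_ne) simp
  with ev0 have "\<forall>\<^sub>F z in at 0. w z \<noteq> 0"
  proof eventually_elim
    case (elim z)
    then have "c (t z) \<noteq> 0" using cz by simp
    then show ?case by (simp add: w_def)
  qed
  then have kw: "((\<lambda>z. 1 / w z * w z) \<longlongrightarrow> 1) (at 0)"
    by (intro Lim_transform_eventually[OF tendsto_const]) (auto elim!: eventually_mono)
  have "\<forall>\<^sub>F z in at 0. t z \<notin> B" if "finite B" for B
  proof -
    have "\<forall>\<^sub>F z in at 0. t z \<noteq> b" for b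
      using ev0 eventually_neq_at_within[of "1 / b"] 
      by eventually_elim (auto simp: t_def)
    then have "\<forall>\<^sub>F z in at 0. \<forall>b\<in>B. t z \<noteq> b" by (intro eventually_ball_finite that) simp
    then show ?thesis by (auto elim!: eventually_mono)
  qed
  moreover have "Affine (t z) (w z) \<in> ec q m" for z
    using w2[of z] by (simp add: ec_def c_def A_def)
  ultimately show ?thesis using that[of t w "\<lambda>z. 1 / w z"] k0 kt kw h Infty by auto
next
  case (Affine T1 W1)
  then have e: "T1 = T0" "W1 = W0" "S0 = 1" using h by auto
  define A where "A = 4 * q^2 - 2 * m"
  define c where "c = (\<lambda>T. T^3 + A * T^2 + m^2 * T)"
  have c0: "W0^2 = c T0" using P Affine e by (auto simp: ec_def c_def A_def)
  define t where "t = (\<lambda>z. T0 + z)"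
  define r where "r = (\<lambda>z. csqrt (c (t z)))"
  \<comment> \<open>\<open>csqrt\<close> has a branch cut, so the root nearer to \<open>W0\<close>
    is taken. Then |w - W0|^2 \<le> |w - W0| |w + W0| = |c(t) - c(T0)|, which tends to 0.\<close>
  define w where "w = (\<lambda>z. if norm (r z - W0) \<le> norm (r z + W0) then r z else - r z)"
  have w2: "(w z)^2 = c (t z)" for z by (simp add: w_def r_def)
  have le: "norm (w z - W0) \<le> norm (w z + W0)" for z
    using norm_minus_cancel[of "r z + W0"] norm_minus_commute[of W0 "r z"]
    by (simp add: w_def)
  have "((\<lambda>z. c (t z) - c T0) \<longlongrightarrow> ((T0 + 0)^3 + A * (T0 + 0)^2 + m^2 * (T0 + 0)) - c T0) (at 0)"
    unfolding c_def t_def by (intro tendsto_intros)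
  then have l0: "((\<lambda>z. c (t z) - c T0) \<longlongrightarrow> 0) (at 0)" by (simp add: c_def)
  have lw: "(w \<longlongrightarrow> W0) (at 0)"
  proof (rule tendsto_if_square_tendsto[OF l0])
    fix z
    have "norm (w z - W0)^2 \<le> norm (w z - W0) * norm (w z + W0)"
      unfolding power2_eq_square by (intro mult_left_mono le) simp
    also have "\<dots> = norm (c (t z) - c T0)"
      unfolding w2[symmetric] c0[symmetric] norm_mult[symmetric]
      by (simp add: algebra_simps power2_eq_square)
    finally show "norm (w z - W0)^2 \<le> norm (c (t z) - c T0)" .
  qed
  have lt: "(t \<longlongrightarrow> T0) (at 0)"
    unfolding t_def using tendsto_add[OF tendsto_const tendsto_ident_at, of T0 0 UNIV] by simp
  have "\<forall>\<^sub>F z in at 0. t z \<notin> B" if "finite B" for B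
  proof -
    have "\<forall>\<^sub>F z in at 0. t z \<noteq> b" for b
      using eventually_neq_at_within[of "b - T0"] by eventually_elim (auto simp: t_def)
    then have "\<forall>\<^sub>F z in at 0. \<forall>b\<in>B. t z \<noteq> b" by (intro eventually_ball_finite that) simp
    then show ?thesis by (auto elim!: eventually_mono)
  qed
  moreover have "Affine (t z) (w z) \<in> ec q m" for z
    using w2[of z] by (simp add: ec_def c_def A_def)
  ultimately show ?thesis using that[of t w "\<lambda>z. 1"] lt lw e by auto
qed


text \<open>Homogeneity carries the zeros of \<open>F\<close> at nearby points [t : w : 1] with t
  outside \<open>B\<close> over to the rescaled coordinates, and continuity carries them to the
  limit.\<close>

lemma rat_form_zero_on_curve:
  assumes F: "rat_form d F" and B: "finite B"
    and zero: "\<And>T W. Affine T W \<in> ec q m \<Longrightarrow> T \<notin> B \<Longrightarrow> F T W 1 = 0"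
    and P: "P \<in> ec q m" and h: "hcoords P = (T, W, S)"
  shows "F T W S = 0"
proof -
  obtain t w k :: "complex \<Rightarrow> complex" where E: "\<forall>z. Affine (t z) (w z) \<in> ec q m"
    and avoid: "\<forall>B. finite B \<longrightarrow> (\<forall>\<^sub>F z in at 0. t z \<notin> B)"
    and lim: "((\<lambda>z. k z * t z) \<longlongrightarrow> T) (at 0)" "((\<lambda>z. k z * w z) \<longlongrightarrow> W) (at 0)"
      "(k \<longlongrightarrow> S) (at 0)"
    by (rule curve_approach[OF P h])
  have "((\<lambda>z. F (k z * t z) (k z * w z) (k z)) \<longlongrightarrow> F T W S) (at 0)"
    by (rule rat_form_tendsto[OF F lim])
  moreover have "\<forall>\<^sub>F z in at 0. F (k z * t z) (k z * w z) (k z) = 0"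
    using avoid[rule_format, OF B]
  proof eventually_elim
    case (elim z)
    show ?case
      using rat_form_homogeneous[OF F, of "k z" "t z" "w z" 1] zero[OF E[rule_format] elim] by simp
  qed
  ultimately have "((\<lambda>z::complex. 0) \<longlongrightarrow> F T W S) (at 0)"
    by (rule Lim_transform_eventually)
  then show ?thesis by (simp add: tendsto_const_iff)
qed

text \<open>Eliminating \<open>W\<close> leaves a^2 (T^3 + A T^2 + B T) - (b T + c)^2 = 0. This
  polynomial is nonzero: its leading coefficient is a^2, and for a = 0 it is -(b T + c)^2.\<close>

lemma finite_line_curve:
  fixes a b c A B :: complex
  assumes "a \<noteq> 0 \<or> b \<noteq> 0 \<or> c \<noteq> 0"
  shows "finite {T. \<exists>W. W^2 = T^3 + A * T^2 + B * T \<and> a * W + b * T + c = 0}"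
proof -
  let ?p = "[:- (c^2), a^2 * B - 2 * b * c, a^2 * A - b^2, a^2:]"
  have "?p \<noteq> 0" using assms by auto
  then have "finite {T. poly ?p T = 0}" by (rule poly_roots_finite)
  moreover have "poly ?p T = 0" if "W^2 = T^3 + A * T^2 + B * T" "a * W + b * T + c = 0" for T W
  proof -
    have "poly ?p T = a^2 * (T^3 + A * T^2 + B * T) - (b * T + c)^2"
      by (simp add: algebra_simps power2_eq_square power3_eq_cube)
    also have "\<dots> = 0" using that by algebra
    finally show ?thesis .
  qed
  ultimately show ?thesis by (auto elim!: rev_finite_subset)
qed

section \<open>Projective equality and equality of morphisms\<close>

lemma proj_eq_if_cross_zero:
  assumes "(X, Y, Z) \<noteq> (0, 0, 0)" "(X', Y', Z') \<noteq> (0, 0, 0)"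
    "X * Y' = X' * Y" "X * Z' = X' * Z" "Y * Z' = Y' * Z"
  shows "proj_eq (X, Y, Z) (X', Y', Z')"
proof -
  consider "X' \<noteq> 0" | "Y' \<noteq> 0" | "Z' \<noteq> 0" using assms(2) by auto
  then show ?thesis
  proof cases
    case 1
    then have "X \<noteq> 0" using assms by auto
    then show ?thesis using 1 assms(3-5) unfolding proj_eq_def
      by (auto intro!: exI[of _ "X / X'"] simp: field_simps)
  next
    case 2
    then have "Y \<noteq> 0" using assms by auto
    then show ?thesis using 2 assms(3-5) unfolding proj_eq_def
      by (auto intro!: exI[of _ "Y / Y'"] simp: field_simps)
  next
    case 3
    then have "Z \<noteq> 0" using assms by auto
    then show ?thesis using 3 assms(3-5) unfolding proj_eq_def
      by (auto intro!: exI[of _ "Z / Z'"] simp: field_simps)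
  qed
qed

lemma proj_eq_cross_zero:
  assumes "proj_eq (X, Y, Z) (X', Y', Z')"
  shows "X * Y' = X' * Y" "X * Z' = X' * Z" "Y * Z' = Y' * Z"
  using assms by (auto simp: proj_eq_def)

lemma proj_eq_sym: "proj_eq u v \<Longrightarrow> proj_eq v u"
proof (cases u; cases v)
  fix X Y Z X' Y' Z'
  assume u: "u = (X, Y, Z)" and v: "v = (X', Y', Z')" and "proj_eq u v"
  then obtain c where "c \<noteq> 0" "X = c * X'" "Y = c * Y'" "Z = c * Z'" by (auto simp: proj_eq_def)
  then show "proj_eq v u" unfolding u v by (auto simp: proj_eq_def intro!: exI[of _ "inverse c"])
qed

lemma proj_eq_trans: "proj_eq u v \<Longrightarrow> proj_eq v w \<Longrightarrow> proj_eq u w"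
  by (cases u; cases v; cases w) (fastforce simp: proj_eq_def intro: exI[of _ "c * d" for c d])

text \<open>Around \<open>P\<close> each map is given by a triple of forms. The 2x2 minors of the
  two triples are forms of degree \<open>d + e\<close> vanishing off \<open>B\<close>, hence at
  \<open>P\<close>, where both triples are nonzero and so proportional.\<close>

lemma morphism_unique:
  assumes \<phi>: "morphism q m \<phi>" and \<psi>: "morphism q m \<psi>" and B: "finite B"
    and agree: "\<And>T W. Affine T W \<in> ec q m \<Longrightarrow> T \<notin> B \<Longrightarrow> proj_eq (\<phi> (Affine T W)) (\<psi> (Affine T W))"
    and P: "P \<in> ec q m"
  shows "proj_eq (\<phi> P) (\<psi> P)"
proof -
  obtain T W S where h: "hcoords P = (T, W, S)" by (metis prod.exhaust)
  obtain d F1 F2 F3 where F: "rat_form d F1" "rat_form d F2" "rat_form d F3"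
    "eval_forms F1 F2 F3 P \<noteq> (0, 0, 0)"
    "\<And>Q. Q \<in> ec q m \<Longrightarrow> eval_forms F1 F2 F3 Q \<noteq> (0, 0, 0) \<Longrightarrow> proj_eq (\<phi> Q) (eval_forms F1 F2 F3 Q)"
    using \<phi> P unfolding morphism_def by metis
  obtain e G1 G2 G3 where G: "rat_form e G1" "rat_form e G2" "rat_form e G3"
    "eval_forms G1 G2 G3 P \<noteq> (0, 0, 0)"
    "\<And>Q. Q \<in> ec q m \<Longrightarrow> eval_forms G1 G2 G3 Q \<noteq> (0, 0, 0) \<Longrightarrow> proj_eq (\<psi> Q) (eval_forms G1 G2 G3 Q)"
    using \<psi> P unfolding morphism_def by metis
  have cross: "F1 T W 1 * G2 T W 1 = G1 T W 1 * F2 T W 1 \<and>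
      F1 T W 1 * G3 T W 1 = G1 T W 1 * F3 T W 1 \<and> F2 T W 1 * G3 T W 1 = G2 T W 1 * F3 T W 1"
    if Q: "Affine T W \<in> ec q m" and "T \<notin> B" for T W
  proof -
    let ?F = "(F1 T W 1, F2 T W 1, F3 T W 1)" and ?G = "(G1 T W 1, G2 T W 1, G3 T W 1)"
    have ev: "eval_forms F1 F2 F3 (Affine T W) = ?F" "eval_forms G1 G2 G3 (Affine T W) = ?G"
      by (simp_all add: eval_forms_def)
    show ?thesis
    proof (cases "?F = (0, 0, 0) \<or> ?G = (0, 0, 0)")
      \<comment> \<open>A triple vanishing at this point says nothing about its morphism, but it
        makes all minors zero.\<close>
      case True
      then show ?thesis by auto
    next
      case False
      then have "proj_eq ?F ?G"
        using F(5)[OF Q] G(5)[OF Q] agree[OF that] unfolding ev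
        by (blast intro: proj_eq_sym proj_eq_trans)
      from proj_eq_cross_zero[OF this] show ?thesis by blast
    qed
  qed
  have zero: "A T W S * A' T W S = C T W S * C' T W S"
    if "rat_form d A" "rat_form e A'" "rat_form e C" "rat_form d C'"
      and eq: "\<And>T W. Affine T W \<in> ec q m \<Longrightarrow> T \<notin> B \<Longrightarrow> A T W 1 * A' T W 1 = C T W 1 * C' T W 1"
    for A A' C C'
  proof -
    have "rat_form (d + e) (\<lambda>T W S. A T W S * A' T W S - C T W S * C' T W S)"
      using rat_form.mult[OF that(1,2)] rat_form.mult[OF that(3,4)]
      by (intro rat_form_diff) (simp_all add: add.commute)
    from rat_form_zero_on_curve[OF this B _ P h] eq show ?thesis by simp
  qed
  have "proj_eq (eval_forms F1 F2 F3 P) (eval_forms G1 G2 G3 P)"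
    unfolding eval_forms_def h prod.case
  proof (rule proj_eq_if_cross_zero)
    show "F1 T W S * G2 T W S = G1 T W S * F2 T W S"
      by (rule zero[OF F(1) G(2) G(1) F(2)]) (use cross in blast)
    show "F1 T W S * G3 T W S = G1 T W S * F3 T W S"
      by (rule zero[OF F(1) G(3) G(1) F(3)]) (use cross in blast)
    show "F2 T W S * G3 T W S = G2 T W S * F3 T W S"
      by (rule zero[OF F(2) G(3) G(2) F(3)]) (use cross in blast)
  qed (use F(4) G(4) in \<open>simp_all add: eval_forms_def h\<close>)
  then show ?thesis
    using F(5)[OF P F(4)] G(5)[OF P G(4)] by (blast intro: proj_eq_sym proj_eq_trans)
qed

section \<open>The descent map\<close>

lemma sq_congI:
  assumes "A \<in> \<rat>" "B \<in> \<rat>" "C \<in> \<rat>" "D \<in> \<rat>" "A \<noteq> 0" "C \<noteq> 0" "A * C^2 = B * D^2"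
  shows "sq_cong A B"
proof -
  have "D \<noteq> 0" using assms by auto
  then show ?thesis unfolding sq_cong_def using assms
    by (intro conjI bexI[of _ "D / C"]) (auto simp: field_simps)
qed

lemma sq_cong_sym: "sq_cong A B \<Longrightarrow> sq_cong B A"
  unfolding sq_cong_def by (auto simp: field_simps intro!: bexI[of _ "inverse s" for s])

lemma sq_cong_mult:
  assumes "sq_cong A B" "sq_cong C D"
  shows "sq_cong (A * C) (B * D)"
proof -
  obtain s t where "s \<in> \<rat>" "s \<noteq> 0" "A = B * s^2" "t \<in> \<rat>" "t \<noteq> 0" "C = D * t^2"
    using assms by (auto simp: sq_cong_def)
  then show ?thesis using assms unfolding sq_cong_def
    by (auto simp: power_mult_distrib intro!: bexI[of _ "s * t"])
qed

lemma sq_cong_trans: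
  assumes "sq_cong A B" "sq_cong B C"
  shows "sq_cong A C"
proof -
  obtain s t where "s \<in> \<rat>" "s \<noteq> 0" "A = B * s^2" "t \<in> \<rat>" "t \<noteq> 0" "B = C * t^2"
    using assms by (auto simp: sq_cong_def)
  then show ?thesis using assms unfolding sq_cong_def
    by (auto simp: power_mult_distrib intro!: bexI[of _ "s * t"])
qed

section \<open>The descent homomorphism\<close>

text \<open>At the 2-torsion point \<open>(0, 0)\<close> the value must be that of the coefficient \<open>m\<^sup>2\<close>, a square.\<close>

fun descent :: "ec_point \<Rightarrow> complex" where
  "descent Infty = 1"
| "descent (Affine T W) = (if T = 0 then 1 else T)"

lemma descent_nonzero: "descent P \<noteq> 0"
  by (cases P) auto

lemma descent_rat: "P \<in> ec_rat q m \<Longrightarrow> descent P \<in> \<rat>"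
  by (auto simp: ec_rat_def)

lemma descent_neg: "descent (ec_neg P) = descent P"
  by (cases P) auto

lemma ec_neg_rat: "P \<in> ec_rat q m \<Longrightarrow> ec_neg P \<in> ec_rat q m"
  by (auto simp: ec_rat_def ec_def)

text \<open>
  The cubic minus the square of the line \<open>W = l T + n\<close> has the roots \<open>T1, T2, T3\<close>; these are the
  lower two of Vieta's formulas.
\<close>

lemma ec_add_vieta:
  fixes q m T1 W1 T2 W2 :: complex
  defines "l \<equiv> if T1 = T2 then (3 * T1^2 + 2 * (4 * q^2 - 2 * m) * T1 + m^2) / (2 * W1)
               else (W2 - W1) / (T2 - T1)"
  defines "T3 \<equiv> l^2 - (4 * q^2 - 2 * m) - T1 - T2" and "n \<equiv> W1 - l * T1"
  assumes P: "Affine T1 W1 \<in> ec q m" and Q: "Affine T2 W2 \<in> ec q m" and ne: "\<not> (T1 = T2 \<and> W1 = - W2)"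
  shows "T1 * T2 + T1 * T3 + T2 * T3 = m^2 - 2 * l * n" "T1 * T2 * T3 = n^2"
proof -
  define a where "a = 4 * q^2 - 2 * m"
  have c1: "W1^2 = T1^3 + a * T1^2 + m^2 * T1" and c2: "W2^2 = T2^3 + a * T2^2 + m^2 * T2"
    using P Q by (auto simp: ec_def a_def)
  have T3: "T3 = l^2 - a - T1 - T2" by (simp add: T3_def a_def)
  have W1: "W1 = l * T1 + n" by (simp add: n_def)
  have "T1 * T2 + T1 * T3 + T2 * T3 = m^2 - 2 * l * n \<and> T1 * T2 * T3 = n^2"
  proof (cases "T1 = T2")
    case True
    then have "W1^2 = W2^2" using c1 c2 by simp
    \<comment> \<open>Equal abscissas without being opposite: the points coincide and
      \<open>W1 \<noteq> 0\<close>, so the tangent slope has a nonzero denominator.\<close>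
    then have "(W1 - W2) * (W1 + W2) = 0" by algebra
    then have "W2 = W1" "W1 \<noteq> 0" using ne True by (auto simp: eq_neg_iff_add_eq_0)
    then have t: "2 * W1 * l = 3 * T1^2 + 2 * a * T1 + m^2"
      using True by (simp add: l_def a_def)
    \<comment> \<open>The slope makes the derivative of the cubic minus the squared line vanish at
      \<open>T1\<close>; with the root sum fixed by \<open>T3\<close>, this is the relation.\<close>
    have e2: "T1 * T2 + T1 * T3 + T2 * T3 = m^2 - 2 * l * n"
      using t unfolding T3 W1 True[symmetric] by algebra
    moreover have "T1 * T2 * T3 = n^2"
      using t c1 unfolding T3 W1 True[symmetric] by algebra
    ultimately show ?thesis ..
  next
    case False
    then have "l * (T2 - T1) = W2 - W1" by (simp add: l_def)
    then have W2: "W2 = l * T2 + n" using W1 by algebra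
    \<comment> \<open>The difference of the two curve equations is divisible by
      \<open>T1 - T2\<close>.\<close>
    have "(T1 - T2) * (T1 * T2 + T1 * T3 + T2 * T3) = (T1 - T2) * (m^2 - 2 * l * n)"
      using c1 c2 unfolding T3 W1 W2 by algebra
    then have e2: "T1 * T2 + T1 * T3 + T2 * T3 = m^2 - 2 * l * n" using False by simp
    \<comment> \<open>\<open>T1\<close> is a root, and the sum and the pairwise products of the
      three abscissas are known, so the constant term is forced.\<close>
    moreover have "T1 * T2 * T3 = n^2"
      using c1 e2 unfolding T3 W1 by algebra
    ultimately show ?thesis ..
  qed
  then show "T1 * T2 + T1 * T3 + T2 * T3 = m^2 - 2 * l * n" "T1 * T2 * T3 = n^2" by blast+
qed

text \<open>If no abscissa vanishes, \<open>e3\<close> says that \<open>T3\<close> and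
  \<open>T1 * T2\<close> agree up to a square. If one vanishes, then n = 0 and \<open>e2\<close>
  makes the product of the other two m^2, in accordance with the value 1 of \<open>descent\<close>
  at T = 0.\<close>

lemma descent_vieta:
  assumes rat: "T1 \<in> \<rat>" "T2 \<in> \<rat>" "T3 \<in> \<rat>" "m \<in> \<rat>" "n \<in> \<rat>" and m: "m \<noteq> 0"
    and e2: "T1 * T2 + T1 * T3 + T2 * T3 = m^2 - 2 * l * n" and e3: "T1 * T2 * T3 = n^2"
  shows "sq_cong (descent (Affine T3 W3)) (descent (Affine T1 W1) * descent (Affine T2 W2))"
proof -
  consider "T1 \<noteq> 0" "T2 \<noteq> 0" "T3 \<noteq> 0" | "T1 = 0" "n = 0" | "T2 = 0" "n = 0" | "T3 = 0" "n = 0"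
    using e3 by fastforce
  then show ?thesis
  proof cases
    case 1
    then show ?thesis using rat e3
      by (auto intro!: sq_congI[of _ _ "T1 * T2" n] simp: power2_eq_square algebra_simps)
  next
    case 2
    then have e: "T2 * T3 = m^2" using e2 by simp
    then have "T2 \<noteq> 0" "T3 \<noteq> 0" using m by auto
    then show ?thesis using rat 2 e
      by (auto intro!: sq_congI[of _ _ T2 m] simp: power2_eq_square algebra_simps)
  next
    case 3
    then have e: "T1 * T3 = m^2" using e2 by simp
    then have "T1 \<noteq> 0" "T3 \<noteq> 0" using m by auto
    then show ?thesis using rat 3 e
      by (auto intro!: sq_congI[of _ _ T1 m] simp: power2_eq_square algebra_simps)
  next
    case 4
    then have e: "T1 * T2 = m^2" using e2 by simp
    then have "T1 \<noteq> 0" "T2 \<noteq> 0" using m by auto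
    then show ?thesis using rat 4 e m
      by (auto intro!: sq_congI[of _ _ m 1])
  qed
qed

lemma ec_add_rat_descent:
  assumes "q \<in> \<rat>" "m \<in> \<rat>" "m \<noteq> 0" and P: "P \<in> ec_rat q m" and Q: "Q \<in> ec_rat q m"
  shows "ec_add q m P Q \<in> ec_rat q m \<and> sq_cong (descent (ec_add q m P Q)) (descent P * descent Q)"
proof -
  have refl: "sq_cong A A" if "A \<in> \<rat>" for A
    using that by (auto simp: sq_cong_def intro!: bexI[of _ 1])
  consider "P = Infty" | "Q = Infty" | T1 W1 T2 W2 where "P = Affine T1 W1" "Q = Affine T2 W2"
    by (metis ec_point.exhaust)
  then show ?thesis
  proof cases
    case 1
    then show ?thesis using Q refl[OF descent_rat[OF Q]] by simp
  next
    case 2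
    then show ?thesis using P refl[OF descent_rat[OF P]] by (cases P) auto
  next
    case (3 T1 W1 T2 W2)
    have r: "T1 \<in> \<rat>" "W1 \<in> \<rat>" "T2 \<in> \<rat>" "W2 \<in> \<rat>"
      and E: "Affine T1 W1 \<in> ec q m" "Affine T2 W2 \<in> ec q m"
      using P Q 3 by (auto simp: ec_rat_def)
    show ?thesis
    proof (cases "T1 = T2 \<and> W1 = - W2")
      case True
      \<comment> \<open>\<open>descent\<close> ignores the sign of \<open>W\<close>, so opposite
        points give a square, matching the value 1 at infinity.\<close>
      then have "ec_add q m P Q = Infty" "descent P * descent Q = descent P ^ 2"
        using 3 by (auto simp: power2_eq_square)
      then show ?thesis using descent_rat[OF P] descent_nonzero[of P]
        by (auto simp: ec_rat_def ec_def intro!: sq_congI[of _ _ "descent P" 1])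
    next
      case False
      define l where "l = (if T1 = T2 then (3 * T1^2 + 2 * (4 * q^2 - 2 * m) * T1 + m^2) / (2 * W1)
               else (W2 - W1) / (T2 - T1))"
      define T3 where "T3 = l^2 - (4 * q^2 - 2 * m) - T1 - T2"
      define n where "n = W1 - l * T1"
      have l: "l \<in> \<rat>" using r assms(1,2) by (auto simp: l_def)
      then have rat: "T3 \<in> \<rat>" "n \<in> \<rat>" using r assms(1,2) by (auto simp: T3_def n_def)
      note v = ec_add_vieta[OF E False, folded l_def, folded T3_def n_def]
      have sum: "ec_add q m P Q = Affine T3 (- (l * T3 + n))"
        unfolding 3 using False by (simp add: Let_def T3_def n_def l_def[symmetric] algebra_simps)
      \<comment> \<open>By Vieta's formulas \<open>T3\<close> is a root of the cubic minus the
        squared line, so the sum lies on the curve.\<close>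
      have "(- (l * T3 + n))^2 = T3^3 + (4 * q^2 - 2 * m) * T3^2 + m^2 * T3"
        using v T3_def by algebra
      then have "ec_add q m P Q \<in> ec_rat q m"
        using l rat unfolding sum by (auto simp: ec_rat_def ec_def)
      moreover have "sq_cong (descent (ec_add q m P Q)) (descent P * descent Q)"
        unfolding sum unfolding 3 by (rule descent_vieta[OF r(1,3) rat(1) assms(2) rat(2) assms(3) v])
      ultimately show ?thesis ..
    qed
  qed
qed

section \<open>Comparison with the descent map\<close>

context quartic_with_point
begin

section \<open>Identification of \<open>f_inv\<close> with the explicit inverse\<close>

text \<open>The first two conditions make the image affine and given by the linear charts; the last
  two say v \<noteq> y1 and v \<noteq> -y1. At such points the conditions on an inverse morphism
  prescribe its value.\<close>

lemma generic_image:
  assumes P: "Affine T W \<in> ec q m"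
    and x2: "lin2 q x1 y1 T W 1 \<noteq> 0" and y2: "lin2 q y1 x1 T (-W) 1 \<noteq> 0"
    and np: "lin1 q y1 x1 T (-W) 1 \<noteq> y1 * lin2 q y1 x1 T (-W) 1"
    and nm: "lin1 q y1 x1 T (-W) 1 \<noteq> - y1 * lin2 q y1 x1 T (-W) 1"
  obtains u v where "(u, v) \<in> quartic q m" "v^2 \<noteq> y1^2" "f_map q x1 y1 u v = Affine T W"
proof -
  define p1 p2 r1 r2 where d: "p1 = lin1 q x1 y1 T W 1" "p2 = lin2 q x1 y1 T W 1"
    "r1 = lin1 q y1 x1 T (-W) 1" "r2 = lin2 q y1 x1 T (-W) 1"
  have nz': "p2 \<noteq> 0" "r2 \<noteq> 0" and ne: "r1 \<noteq> y1 * r2" "r1 \<noteq> - y1 * r2"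
    using x2 y2 np nm by (auto simp: d)
  have ex: "explicit_inverse q x1 y1 (Affine T W) = (p1 * r2, p2 * r1, p2 * r2)"
    using x2 y2 by (simp add: explicit_inverse_def x_chart_def y_chart_def d)
  then have pe: "proj_eq (explicit_inverse q x1 y1 (Affine T W)) (p1 / p2, r1 / r2, 1)"
    using nz' by (auto simp: proj_eq_def intro!: exI[of _ "p2 * r2"])
  have charts: "x_chart q x1 y1 (Affine T W) = (p1, p2)" "y_chart q x1 y1 (Affine T W) = (r1, r2)"
    using x2 y2 by (simp_all add: x_chart_def y_chart_def d)
  have "(p1^2 - q * p2^2) * (r1^2 - q * r2^2) = m * p2^2 * r2^2"
    using charts_at(6)[OF P _ charts] by (simp add: identities_def m_eq)
  moreover have "(p1 / p2)^2 - q = (p1^2 - q * p2^2) / p2^2" "(r1 / r2)^2 - q = (r1^2 - q * r2^2) / r2^2"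
    using nz' by (simp_all add: field_simps)
  ultimately have "(p1 / p2, r1 / r2) \<in> quartic q m"
    using nz' by (simp add: quartic_def)
  moreover have "(r1 / r2)^2 \<noteq> y1^2"
  proof
    assume "(r1 / r2)^2 = y1^2"
    then have "(r1 - y1 * r2) * (r1 + y1 * r2) = 0"
      using nz' by (simp add: field_simps power2_eq_square)
    then show False using ne by (simp add: eq_neg_iff_add_eq_0)
  qed
  ultimately show ?thesis using that explicit_inverse_right[OF P pe] by blast
qed

text \<open>Each of the four conditions fails only on a line in the (T, W)-plane, which meets the
  curve over finitely many T.\<close>

lemma finite_nongeneric:
  obtains B where "finite B"
    "\<And>T W. Affine T W \<in> ec q m \<Longrightarrow> T \<notin> B \<Longrightarrow>
      lin2 q x1 y1 T W 1 \<noteq> 0 \<and> lin2 q y1 x1 T (-W) 1 \<noteq> 0 \<and>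
      lin1 q y1 x1 T (-W) 1 \<noteq> y1 * lin2 q y1 x1 T (-W) 1 \<and>
      lin1 q y1 x1 T (-W) 1 \<noteq> - y1 * lin2 q y1 x1 T (-W) 1"
proof -
  let ?Z = "\<lambda>a b c. {T. \<exists>W. W^2 = T^3 + (4 * q^2 - 2 * m) * T^2 + m^2 * T \<and> a * W + b * T + c = 0}"
  let ?B = "?Z y1 (- x1 * (y1^2 + q)) (x1 * (y1^2 - q) * m) \<union>
    ?Z (- x1) (- y1 * (x1^2 + q)) (y1 * (x1^2 - q) * m) \<union>
    ?Z 0 (2 * x1^2 * (y1^2 - q)) (- 2 * y1^2 * (x1^2 - q) * m) \<union>
    ?Z (- 2 * x1 * y1) (- 2 * q * (x1^2 + y1^2)) 0"
  \<comment> \<open>None of the four equations is identically zero. All of them would be if x1 = y1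
    = 0, which m \<noteq> q^2 excludes through \<open>nz\<close>.\<close>
  have "y1 \<noteq> 0 \<or> - x1 * (y1^2 + q) \<noteq> 0" "- x1 \<noteq> 0 \<or> - y1 * (x1^2 + q) \<noteq> 0"
    "2 * x1^2 * (y1^2 - q) \<noteq> 0 \<or> - 2 * y1^2 * (x1^2 - q) * m \<noteq> 0"
    "- 2 * x1 * y1 \<noteq> 0 \<or> - 2 * q * (x1^2 + y1^2) \<noteq> 0"
    using nz x1q y1q q0 m0 by auto
  then have "finite ?B"
    by (intro finite_UnI finite_line_curve) blast+
  moreover have "lin2 q x1 y1 T W 1 \<noteq> 0 \<and> lin2 q y1 x1 T (-W) 1 \<noteq> 0 \<and>
      lin1 q y1 x1 T (-W) 1 \<noteq> y1 * lin2 q y1 x1 T (-W) 1 \<and>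
      lin1 q y1 x1 T (-W) 1 \<noteq> - y1 * lin2 q y1 x1 T (-W) 1"
    if P: "Affine T W \<in> ec q m" and T: "T \<notin> ?B" for T W
  proof -
    have c: "W^2 = T^3 + (4 * q^2 - 2 * m) * T^2 + m^2 * T" using P by (simp add: ec_def)
    have n: "a * W + b * T + c \<noteq> 0" if "T \<notin> ?Z a b c" for a b c using that c by blast
    have e1: "lin2 q x1 y1 T W 1 = y1 * W + (- x1 * (y1^2 + q)) * T + x1 * (y1^2 - q) * m"
      by (simp add: lin2_def m_eq)
    have e2: "lin2 q y1 x1 T (-W) 1 = (- x1) * W + (- y1 * (x1^2 + q)) * T + y1 * (x1^2 - q) * m"
      by (simp add: lin2_def m_eq')
    have e3: "lin1 q y1 x1 T (-W) 1 - y1 * lin2 q y1 x1 T (-W) 1 =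
        0 * W + (2 * x1^2 * (y1^2 - q)) * T + (- 2 * y1^2 * (x1^2 - q) * m)"
      unfolding lin1_def lin2_def m_eq' by algebra
    have e4: "lin1 q y1 x1 T (-W) 1 + y1 * lin2 q y1 x1 T (-W) 1 =
        (- 2 * x1 * y1) * W + (- 2 * q * (x1^2 + y1^2)) * T + 0"
      unfolding lin1_def lin2_def m_eq' by algebra
    have "lin2 q x1 y1 T W 1 \<noteq> 0" unfolding e1 by (rule n) (use T in blast)
    moreover have "lin2 q y1 x1 T (-W) 1 \<noteq> 0" unfolding e2 by (rule n) (use T in blast)
    moreover have "lin1 q y1 x1 T (-W) 1 - y1 * lin2 q y1 x1 T (-W) 1 \<noteq> 0"
      unfolding e3 by (rule n) (use T in blast)
    moreover have "lin1 q y1 x1 T (-W) 1 + y1 * lin2 q y1 x1 T (-W) 1 \<noteq> 0"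
      unfolding e4 by (rule n) (use T in blast)
    ultimately show ?thesis by (simp add: eq_neg_iff_add_eq_0)
  qed
  ultimately show ?thesis by (rule that[of ?B])
qed

text \<open>\<open>f_inv\<close> is an arbitrary choice among inverse morphisms; this pins its
  values down up to scaling and lets the charts compute \<open>g\<close>.\<close>

lemma f_inv_explicit:
  assumes P: "P \<in> ec q m"
  shows "proj_eq (f_inv q m x1 y1 P) (explicit_inverse q x1 y1 P)"
proof -
  obtain B where B: "finite B"
    "\<And>T W. Affine T W \<in> ec q m \<Longrightarrow> T \<notin> B \<Longrightarrow>
      lin2 q x1 y1 T W 1 \<noteq> 0 \<and> lin2 q y1 x1 T (-W) 1 \<noteq> 0 \<and>
      lin1 q y1 x1 T (-W) 1 \<noteq> y1 * lin2 q y1 x1 T (-W) 1 \<and>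
      lin1 q y1 x1 T (-W) 1 \<noteq> - y1 * lin2 q y1 x1 T (-W) 1"
    using finite_nongeneric by metis
  have mor: "morphism q m (f_inv q m x1 y1)" "morphism q m (explicit_inverse q x1 y1)"
    using inverse_morphism_f_inv inverse_morphism_explicit by (simp_all add: inverse_morphism_def)
  show ?thesis
  proof (rule morphism_unique[OF mor B(1) _ P])
    fix T W assume Q: "Affine T W \<in> ec q m" "T \<notin> B"
    obtain u v where "(u, v) \<in> quartic q m" "v^2 \<noteq> y1^2" "f_map q x1 y1 u v = Affine T W"
      using generic_image[OF Q(1)] B(2)[OF Q] by metis
    then have "proj_eq (f_inv q m x1 y1 (Affine T W)) (u, v, 1)"
      "proj_eq (explicit_inverse q x1 y1 (Affine T W)) (u, v, 1)"
      using inverse_morphism_f_inv explicit_inverse_left unfolding inverse_morphism_def by metis+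
    then show "proj_eq (f_inv q m x1 y1 (Affine T W)) (explicit_inverse q x1 y1 (Affine T W))"
      by (blast intro: proj_eq_sym proj_eq_trans)
  qed
qed


section \<open>Values of \<open>g\<close> at rational points\<close>

lemma charts_rat:
  assumes "P \<in> ec_rat q m"
    and "x_chart q x1 y1 P = (p1, p2)" "y_chart q x1 y1 P = (r1, r2)"
  shows "p1 \<in> \<rat>" "p2 \<in> \<rat>" "r1 \<in> \<rat>" "r2 \<in> \<rat>"
proof -
  obtain T W S where h: "hcoords P = (T, W, S)" by (metis prod.exhaust)
  then have r: "T \<in> \<rat>" "W \<in> \<rat>" "S \<in> \<rat>" using assms(1) by (auto simp: ec_rat_def)
  have "lin1 q x y T W S \<in> \<rat> \<and> lin2 q x y T W S \<in> \<rat> \<and> quad1 q x y T W S \<in> \<rat> \<and> quad2 q x y T W S \<in> \<rat>"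
    if "x \<in> \<rat>" "y \<in> \<rat>" "W \<in> \<rat>" for x y W
    using that r rat(1) by (simp add: lin1_def lin2_def quad1_def quad2_def cof_def)
  then show "p1 \<in> \<rat>" "p2 \<in> \<rat>" "r1 \<in> \<rat>" "r2 \<in> \<rat>"
    using assms(2,3) r rat unfolding x_chart_def y_chart_def h by (auto split: if_splits)
qed

lemma g_defined_iff:
  assumes P: "P \<in> ec q m"
    and "x_chart q x1 y1 P = (p1, p2)" "y_chart q x1 y1 P = (r1, r2)"
  shows "g_defined q m x1 y1 P \<longleftrightarrow> p2 \<noteq> 0 \<and> r2 \<noteq> 0"
  using f_inv_explicit[OF P] assms(2,3)
  by (auto simp: g_defined_def explicit_inverse_def proj_eq_def)

lemma x_f_inv_eq:
  assumes P: "P \<in> ec q m"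
    and "x_chart q x1 y1 P = (p1, p2)" "y_chart q x1 y1 P = (r1, r2)" and "p2 \<noteq> 0" "r2 \<noteq> 0"
  shows "x_f_inv q m x1 y1 P = p1 / p2"
  using f_inv_explicit[OF P] assms(2-)
  by (auto simp: x_f_inv_def explicit_inverse_def proj_eq_def)

text \<open>Multiplying T (v - y1)^2 = (y1^2 - q)(v^2 - q)(u + x1)^2 by g gives T g (v - y1)^2 = m^2
  (u + x1)^2, so T g is a square if T \<noteq> 0 and v \<noteq> y1. At infinity and at T = 0 one has
  u^2 = x1^2, so g is a square there.\<close>

lemma g_descent:
  assumes P: "P \<in> ec_rat q m" and "g_defined q m x1 y1 P"
  shows "sq_cong (g q m x1 y1 P) (descent P)"
proof -
  have E: "P \<in> ec q m" using P by (simp add: ec_rat_def)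
  obtain T W S p1 p2 r1 r2 where h: "hcoords P = (T, W, S)"
    and p: "x_chart q x1 y1 P = (p1, p2)" and r: "y_chart q x1 y1 P = (r1, r2)"
    by (metis prod.exhaust)
  note c = charts_at[OF E h p r]
  have nz2: "p2 \<noteq> 0" "r2 \<noteq> 0" using g_defined_iff[OF E p r] assms(2) by auto
  define u v where "u = p1 / p2" "v = r1 / r2"
  have uv: "p1 = u * p2" "r1 = v * r2" using nz2 by (simp_all add: u_v_def)
  have rats: "u \<in> \<rat>" "v \<in> \<rat>" using charts_rat[OF P p r] by (auto simp: u_v_def)
  have m_rat: "m \<in> \<rat>" using rat by (simp flip: m_eq)
  have g: "g q m x1 y1 P = (x1^2 - q) * (u^2 - q)"
    using x_f_inv_eq[OF E p r nz2] by (simp add: g_def u_v_def)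
  note i = c(6)[unfolded identities_def uv m_eq]
  note i1 = i[THEN conjunct1] and i2 = i[THEN conjunct2, THEN conjunct1]
    and i3 = i[THEN conjunct2, THEN conjunct2]
  \<comment> \<open>Exchanging the two coordinates and negating \<open>W\<close> gives a second
    formula for T, for use where v = y1 makes the first one uninformative.\<close>
  have "identities q y1 x1 T (-W) S r1 r2 p1 p2"
    by (rule chart_identities[OF hcoords_on_curve(2)[OF E h] nz(2) c(2)]) (use c(1) in simp)
  note j2 = this[unfolded identities_def uv, THEN conjunct2, THEN conjunct1]
  have "((u^2-q)*(v^2-q)) * (p2^2*r2^2) = m * (p2^2*r2^2)" using i1 by algebra
  then have D: "(u^2-q)*(v^2-q) = m" using nz2 by simp
  have "(T * (v-y1)^2) * (p2^2*r2^2) = ((y1^2-q)*(v^2-q)*(u+x1)^2*S) * (p2^2*r2^2)"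
    using i2 by algebra
  then have T: "T * (v-y1)^2 = (y1^2-q)*(v^2-q)*(u+x1)^2*S" using nz2 by simp
  have "(T * (u-x1)^2) * (p2^2*r2^2) = ((x1^2-q)*(u^2-q)*(v+y1)^2*S) * (p2^2*r2^2)"
    using j2 by algebra
  then have T': "T * (u-x1)^2 = (x1^2-q)*(u^2-q)*(v+y1)^2*S" using nz2 by simp
  \<comment> \<open>This relation serves the point at infinity, where T = S = 0 reduces both
    formulas for T to 0 = 0.\<close>
  have "(W * (v^2-y1^2)) * (p2*r2^2) = (T * (2*y1*u*(q-v^2) + 2*x1*v*(q-y1^2))) * (p2*r2^2)"
    using i3 by algebra
  then have W: "W * (v^2-y1^2) = T * (2*y1*u*(q-v^2) + 2*x1*v*(q-y1^2))" using nz2 by simp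
  have nzq: "u^2 - q \<noteq> 0" "v^2 - q \<noteq> 0" using D m0 by auto
  have g_rat: "g q m x1 y1 P \<in> \<rat>" and g0: "g q m x1 y1 P \<noteq> 0"
    using rats rat x1q nzq by (auto simp: g)
  have square: "sq_cong (g q m x1 y1 P) 1" if "u^2 = x1^2"
    by (rule sq_congI[of _ _ 1 "x1^2 - q"])
      (use g_rat g0 that rat in \<open>auto simp: g power2_eq_square\<close>)
  have u_sq: "u^2 = x1^2" if "v^2 = y1^2"
  proof -
    have "(u^2 - q) * (y1^2 - q) = (x1^2 - q) * (y1^2 - q)" using D that m_eq by simp
    then show ?thesis using y1q by simp
  qed
  show ?thesis
  proof (cases P)
    case Infty
    then have "v^2 = y1^2" using W h by simp
    then show ?thesis using square u_sq Infty by simp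
  next
    case (Affine T1 W1)
    then have S: "S = 1" and P': "P = Affine T W" using h by auto
    have T_rat: "T \<in> \<rat>" using P P' by (auto simp: ec_rat_def)
    show ?thesis
    proof (cases "T = 0")
      case True
      then have "u = - x1" using T S nzq y1q by (simp add: eq_neg_iff_add_eq_0)
      then show ?thesis using square True P' by simp
    next
      case False
      have "sq_cong (g q m x1 y1 P) T"
      proof (cases "v = y1")
        case False
        have "u + x1 \<noteq> 0" using T False \<open>T \<noteq> 0\<close> by auto
        \<comment> \<open>This is T g (v - y1)^2 = m^2 (u + x1)^2 multiplied once more by g, so that
          g and T stand on opposite sides.\<close>
        moreover have "g q m x1 y1 P * (m * (u + x1))^2 = T * (g q m x1 y1 P * (v - y1))^2"
        proof -
          have "T * (g q m x1 y1 P * (v - y1))^2 = g q m x1 y1 P ^ 2 * (T * (v - y1)^2)" by algebra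
          also have "\<dots> = g q m x1 y1 P * ((x1^2-q) * (y1^2-q)) * ((u^2-q)*(v^2-q)) * (u + x1)^2"
            unfolding T S g by algebra
          also have "\<dots> = g q m x1 y1 P * (m * (u + x1))^2" unfolding m_eq D by algebra
          finally show ?thesis ..
        qed
        ultimately show ?thesis
          by (intro sq_congI[of _ _ "m * (u + x1)" "g q m x1 y1 P * (v - y1)"])
            (use g_rat g0 T_rat m0 m_rat rats rat in auto)
      next
        case True
        then have ux: "u = - x1" using T S nzq y1q by (simp add: eq_neg_iff_add_eq_0)
        \<comment> \<open>The second formula at u = -x1, v = y1. It also excludes y1 = 0, which
          would force x1 = 0 as T \<noteq> 0.\<close>
        have e: "T * (2 * x1)^2 = g q m x1 y1 P * (2 * y1)^2"
          using T' unfolding ux True S g by algebra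
        have "y1 \<noteq> 0" using e \<open>T \<noteq> 0\<close> nz by auto
        then show ?thesis
          by (intro sq_congI[of _ _ "2 * y1" "2 * x1"]) (use g_rat g0 T_rat rat e in auto)
      qed
      then show ?thesis using P' False by simp
    qed
  qed
qed

text \<open>At an image at infinity one chart denominator vanishes, and the quartic relation then
  exhibits q as the square of the other, rational, coordinate.\<close>

lemma g_defined_if_nonsquare:
  assumes nsq: "\<nexists>r. r \<in> \<rat> \<and> q = r^2" and P: "P \<in> ec_rat q m"
  shows "g_defined q m x1 y1 P"
proof -
  have E: "P \<in> ec q m" using P by (simp add: ec_rat_def)
  obtain T W S p1 p2 r1 r2 where h: "hcoords P = (T, W, S)"
    and p: "x_chart q x1 y1 P = (p1, p2)" and r: "y_chart q x1 y1 P = (r1, r2)"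
    by (metis prod.exhaust)
  note c = charts_at[OF E h p r] and rats = charts_rat[OF P p r]
  have i: "(p1^2 - q * p2^2) * (r1^2 - q * r2^2) = m * p2^2 * r2^2"
    using c(6) by (simp add: identities_def m_eq)
  have no: "a^2 \<noteq> q * b^2" if "a \<in> \<rat>" "b \<in> \<rat>" "b \<noteq> 0" for a b
  proof
    assume e: "a^2 = q * b^2"
    have "q = (a / b)^2" unfolding power_divide e using that by simp
    moreover have "a / b \<in> \<rat>" using that by simp
    ultimately have "\<exists>r. r \<in> \<rat> \<and> q = r^2" by (intro exI conjI)
    with nsq show False by contradiction
  qed
  have "p2 \<noteq> 0"
  proof
    assume "p2 = 0"
    moreover from this have "p1 \<noteq> 0" "r2 \<noteq> 0" using c(3,5) by auto
    ultimately show False using i no[OF rats(3,4)] by simp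
  qed
  moreover have "r2 \<noteq> 0"
  proof
    assume "r2 = 0"
    moreover from this have "r1 \<noteq> 0" "p2 \<noteq> 0" using c(4,5) by auto
    ultimately show False using i no[OF rats(1,2)] by simp
  qed
  ultimately show ?thesis using g_defined_iff[OF E p r] by simp
qed

end

text \<open>Images at infinity give \<open>g\<close> no value, so the congruences are restricted to
  points with values; the last conjunct tells when all rational points have one.\<close>

theorem theorem6:
  fixes q m x1 y1 :: complex
  assumes "q \<in> \<rat>" and "q \<noteq> 0"
    and "m \<in> \<rat>" and "m \<noteq> 0" and "m \<noteq> q^2"
    and "x1 \<in> \<rat>" and "y1 \<in> \<rat>" and "(x1, y1) \<in> quartic q m"
  shows "(\<forall>P\<in>ec_rat q m. \<forall>Q\<in>ec_rat q m.
            g_defined q m x1 y1 P \<longrightarrow> g_defined q m x1 y1 Q \<longrightarrow>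
            g_defined q m x1 y1 (ec_add q m P Q) \<longrightarrow>
            sq_cong (g q m x1 y1 (ec_add q m P Q)) (g q m x1 y1 P * g q m x1 y1 Q)) \<and>
         (\<forall>P\<in>ec_rat q m. \<forall>Q\<in>ec_rat q m.
            g_defined q m x1 y1 P \<longrightarrow> g_defined q m x1 y1 Q \<longrightarrow> cong_2E q m P Q \<longrightarrow>
            sq_cong (g q m x1 y1 P) (g q m x1 y1 Q)) \<and>
         ((\<nexists>r. r \<in> \<rat> \<and> q = r^2) \<longrightarrow> (\<forall>P\<in>ec_rat q m. g_defined q m x1 y1 P))"
proof -
  interpret quartic_with_point q m x1 y1
    by unfold_locales (use assms in auto)
  note add = ec_add_rat_descent[OF assms(1,3,4)]
  have "sq_cong (g q m x1 y1 (ec_add q m P Q)) (g q m x1 y1 P * g q m x1 y1 Q)"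
    if "P \<in> ec_rat q m" "Q \<in> ec_rat q m" "g_defined q m x1 y1 P" "g_defined q m x1 y1 Q"
      "g_defined q m x1 y1 (ec_add q m P Q)" for P Q
    using that add[of P Q]
    by (blast intro: g_descent sq_cong_mult sq_cong_sym sq_cong_trans)
  moreover have "sq_cong (g q m x1 y1 P) (g q m x1 y1 Q)"
    if P: "P \<in> ec_rat q m" and Q: "Q \<in> ec_rat q m"
      and def: "g_defined q m x1 y1 P" "g_defined q m x1 y1 Q"
      and cong: "cong_2E q m P Q" for P Q
  proof -
    obtain R where R: "R \<in> ec_rat q m" "ec_add q m P (ec_neg Q) = ec_add q m R R"
      using cong by (auto simp: cong_2E_def)
    \<comment> \<open>\<open>g\<close> may lack a value at \<open>R\<close> or at the sum, so the
      argument runs through \<open>descent\<close>, which is total, and returns to \<open>g\<close>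
      only at \<open>P\<close> and \<open>Q\<close>.\<close>
    have "sq_cong (descent P * descent Q) (descent R * descent R)"
      using add[OF P ec_neg_rat[OF Q]] add[OF R(1) R(1)] unfolding R(2) descent_neg
      by (blast intro: sq_cong_sym sq_cong_trans)
    then obtain s where "s \<in> \<rat>" "s \<noteq> 0" "descent P * descent Q = descent R * descent R * s^2"
      by (auto simp: sq_cong_def)
    then have "sq_cong (descent P) (descent Q)"
      using descent_nonzero descent_rat[OF P] descent_rat[OF Q] descent_rat[OF R(1)]
      by (intro sq_congI[of _ _ "descent Q" "descent R * s"])
        (auto simp: power_mult_distrib power2_eq_square mult.assoc mult.left_commute)
    then show ?thesis
      using g_descent[OF P def(1)] g_descent[OF Q def(2)] by (blast intro: sq_cong_sym sq_cong_trans)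
  qed
  moreover have "g_defined q m x1 y1 P" if "\<nexists>r. r \<in> \<rat> \<and> q = r^2" "P \<in> ec_rat q m" for P
    by (rule g_defined_if_nonsquare[OF that])
  ultimately show ?thesis by blast
qed

end
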